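(* Let $G$ be a $\overline{C}$-group, with a fixed $\overline{C}$-type presentation $\Pi$ with generator set $\Gamma$. Let $\mathcal{O}$ be a conjugacy class of $G$, $a_{\mathcal{O}}\in\mathcal{O}$ any representative, and $\mathcal{O}_1=\{1_G\}$ the conjugacy class of $1_G$. Then $$\left(\mathrm{Stab}_{A(G)}(a_{\mathcal{O}})\cap\operatorname{Ker}(\varepsilon)\right)_{Ab}\ \cong\ \left(\mathrm{Stab}_{G^{\mathcal{D}}}(a_{\mathcal{O}})\right)_{Ab}\times\mathbb{Z}^{\mathfrak{C}_{\mathrm{ng}}(G)\setminus\{\mathcal{O}_1\}}.$$ Further, the map $\pi\colon G^{\mathcal{D}}\twoheadrightarrow G$ induces a short exact sequence $$0\ \to\ \mathbb{Z}^{\mathfrak{C}_{\mathrm{fg}}(G)}\ \to\ \left(\mathrm{Stab}_{G^{\mathcal{D}}}(a_{\mathcal{O}})\right)_{Ab}\ \to\ \left(\mathrm{Stab}_{G}(a_{\mathcal{O}})\right)_{Ab}\ \to\ 0.$$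
   Context: For a group $G$, put $a\triangleleft b=b^{-1}ab$ and $A(G)=\langle e_a,\ a\in G\mid e_ae_b=e_be_{a\triangleleft b},\ a,b\in G\rangle$; $\varepsilon\colon A(G)\to\mathbb{Z}$ is the homomorphism sending each $e_a$ to $1$. For a set $X$, $\mathbb{Z}^X$ is the free abelian group with basis $(c_x)_{x\in X}$ (direct sum). $H_{Ab}$ denotes the abelianisation of a group $H$. A $\overline{C}$-group is a group $G$ admitting a presentation $\Pi$ (a $\overline{C}$-type presentation), with some generator set $\Gamma$, in which every relation is either a conjugation relation $b^{-1}ab=c$ with $a,b,c\in\Gamma$, or a power relation $a^k=1$ with $a\in\Gamma$, $k\ge 2$; there is at most one power relation per conjugacy class of $G$ (i.e., for each conjugacy class $\mathcal{O}$ of $G$, at most one power relation $a^k=1$ has $a\in\mathcal{O}$). $\mathfrak{C}_{\mathrm{ng}}(G)$ is the set of conjugacy classes of $G$ containing no element of $\Gamma$ (it contains $\mathcal{O}_1$); $\mathfrak{C}_{\mathrm{fg}}(G)$ is the set of conjugacy classes of $G$ containing an element of $\Gamma$ and consisting of elements of finite order; for such a class $\mathcal{O}'$, $k(\mathcal{O}')$ is the order of its elements. The Dehn quandle $\Gamma^G$ is the union of the $G$-conjugacy classes of the elements of $\Gamma$ in $G$, and $G^{\mathcal{D}}=\langle e_a,\ a\in\Gamma^G\mid e_ae_b=e_be_{a\triangleleft b},\ a,b\in\Gamma^G\rangle$, with $\pi\colon G^{\mathcal{D}}\to G$, $e_a\mapsto a$. The kernel of this $\pi$ is central and identified with $\mathbb{Z}^{\mathfrak{C}_{\mathrm{fg}}(G)}$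 via $c_{\mathcal{O}'}\mapsto e_b^{k(\mathcal{O}')}$ for any $b\in\mathcal{O}'$; the first map of the short exact sequence is induced by the inclusion of this kernel. $A(G)$ and $G^{\mathcal{D}}$ act on the set $G$ on the right via $a\cdot e_b=a\triangleleft b$, and $G$ acts on itself by $a\cdot b=a\triangleleft b$; stabilisers are with respect to these actions. *)

theory Defs
  imports
    "HOL-Algebra.Group_Action"
    "HOL-Algebra.Generated_Groups"
    "HOL-Algebra.Elementary_Groups"
    "HOL-Algebra.Multiplicative_Group"
    "HOL-Algebra.Free_Abelian_Groups"
begin

section \<open>Groups given by generators and relations\<close>

text \<open>The letter \<open>(x, True)\<close> stands for \<open>x\<close>, and \<open>(x, False)\<close> for the inverse of \<open>x\<close>.
  A pair of words \<open>(u, v)\<close> encodes the relation \<open>u = v\<close>.\<close>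

type_synonym 'x word = "('x \<times> bool) list"

definition words :: "'x set \<Rightarrow> 'x word set" where
  "words X = lists (X \<times> UNIV)"

inductive word_equiv :: "'x set \<Rightarrow> ('x word \<times> 'x word) set \<Rightarrow> 'x word \<Rightarrow> 'x word \<Rightarrow> bool"
  for X R where
  refl: "w \<in> words X \<Longrightarrow> word_equiv X R w w"
| sym: "word_equiv X R u v \<Longrightarrow> word_equiv X R v u"
| trans: "word_equiv X R u v \<Longrightarrow> word_equiv X R v w \<Longrightarrow> word_equiv X R u w"
| append: "word_equiv X R u u' \<Longrightarrow> word_equiv X R v v' \<Longrightarrow> word_equiv X R (u @ v) (u' @ v')"
| cancel: "x \<in> X \<Longrightarrow> word_equiv X R [(x, s), (x, \<not> s)] []"
| relation: "(u, v) \<in> R \<Longrightarrow> u \<in> words X \<Longrightarrow> v \<in> words X \<Longrightarrow> word_equiv X R u v"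

definition word_rel :: "'x set \<Rightarrow> ('x word \<times> 'x word) set \<Rightarrow> ('x word \<times> 'x word) set" where
  "word_rel X R = {(u, v). word_equiv X R u v}"

definition presented_group :: "'x set \<Rightarrow> ('x word \<times> 'x word) set \<Rightarrow> 'x word set monoid" where
  "presented_group X R =
     \<lparr>carrier = words X // word_rel X R,
      mult = (\<lambda>U V. \<Union>u\<in>U. \<Union>v\<in>V. word_rel X R `` {u @ v}),
      one = word_rel X R `` {[]}\<rparr>"

definition pres_gen :: "'x set \<Rightarrow> ('x word \<times> 'x word) set \<Rightarrow> 'x \<Rightarrow> 'x word set" where
  "pres_gen X R x = word_rel X R `` {[(x, True)]}"

definition word_eval :: "('b, 'm) monoid_scheme \<Rightarrow> ('x \<Rightarrow> 'b) \<Rightarrow> 'x word \<Rightarrow> 'b" where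
  "word_eval H f w =
     foldr (\<lambda>(x, s) y. (if s then f x else inv\<^bsub>H\<^esub> (f x)) \<otimes>\<^bsub>H\<^esub> y) w \<one>\<^bsub>H\<^esub>"

text \<open>The homomorphism from a presented group to \<open>H\<close> that sends each generator \<open>x\<close> to \<open>f x\<close>;
  meaningful only if \<open>f\<close> respects the relations (see \<open>pres_hom_hom\<close>, \<open>pres_hom_gen\<close> below).\<close>

definition pres_hom :: "('b, 'm) monoid_scheme \<Rightarrow> ('x \<Rightarrow> 'b) \<Rightarrow> 'x word set \<Rightarrow> 'b" where
  "pres_hom H f U = the_elem (word_eval H f ` U)"


section \<open>Conjugation, adjoint groups and their actions\<close>

definition conj_op :: "('g, 'm) monoid_scheme \<Rightarrow> 'g \<Rightarrow> 'g \<Rightarrow> 'g" (infixl \<open>\<triangleleft>\<index>\<close> 70) where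
  "a \<triangleleft>\<^bsub>G\<^esub> b = inv\<^bsub>G\<^esub> b \<otimes>\<^bsub>G\<^esub> a \<otimes>\<^bsub>G\<^esub> b"

text \<open>This is a right action, whereas the library's \<open>group_action\<close> is a left action; \<open>orbit\<close> and
  \<open>stabilizer\<close> make sense for both.\<close>

definition conj_act :: "('g, 'm) monoid_scheme \<Rightarrow> 'g \<Rightarrow> 'g \<Rightarrow> 'g" where
  "conj_act G b = (\<lambda>a\<in>carrier G. a \<triangleleft>\<^bsub>G\<^esub> b)"

definition conj_classes :: "('g, 'm) monoid_scheme \<Rightarrow> 'g set set" where
  "conj_classes G = orbits G (carrier G) (conj_act G)"

definition adjoint_relations :: "('g, 'm) monoid_scheme \<Rightarrow> 'g set \<Rightarrow> ('g word \<times> 'g word) set" where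
  "adjoint_relations G Q =
     {([(a, True), (b, True)], [(b, True), (a \<triangleleft>\<^bsub>G\<^esub> b, True)]) | a b. a \<in> Q \<and> b \<in> Q}"

text \<open>For a union \<open>Q\<close> of conjugacy classes of \<open>G\<close>:
  \<open>\<langle>e\<^sub>a, a \<in> Q | e\<^sub>a e\<^sub>b = e\<^sub>b e\<^bsub>a \<triangleleft> b\<^esub>, a, b \<in> Q\<rangle>\<close>.\<close>

definition adjoint_group :: "('g, 'm) monoid_scheme \<Rightarrow> 'g set \<Rightarrow> 'g word set monoid" where
  "adjoint_group G Q = presented_group Q (adjoint_relations G Q)"

definition adjoint_gen :: "('g, 'm) monoid_scheme \<Rightarrow> 'g set \<Rightarrow> 'g \<Rightarrow> 'g word set" where
  "adjoint_gen G Q a = pres_gen Q (adjoint_relations G Q) a"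

definition adjoint_eps :: "'g word set \<Rightarrow> int" where
  "adjoint_eps = pres_hom integer_group (\<lambda>a. 1)"

definition adjoint_proj :: "('g, 'm) monoid_scheme \<Rightarrow> 'g word set \<Rightarrow> 'g" where
  "adjoint_proj G = pres_hom G (\<lambda>a. a)"

definition opposite_group :: "('b, 'm) monoid_scheme \<Rightarrow> ('b, 'm) monoid_scheme" where
  "opposite_group H = H\<lparr>mult := (\<lambda>x y. y \<otimes>\<^bsub>H\<^esub> x)\<rparr>"

text \<open>The right action of an adjoint group on \<open>carrier G\<close> determined by \<open>a \<cdot> e\<^sub>b = a \<triangleleft> b\<close>.
  A right action is a homomorphism to the opposite of the group of bijections, whose
  multiplication is composition of maps.\<close>

definition adjoint_act :: "('g, 'm) monoid_scheme \<Rightarrow> 'g word set \<Rightarrow> 'g \<Rightarrow> 'g" where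
  "adjoint_act G = pres_hom (opposite_group (BijGroup (carrier G))) (conj_act G)"

definition dehn_quandle :: "('g, 'm) monoid_scheme \<Rightarrow> 'g set \<Rightarrow> 'g set" where
  "dehn_quandle G S = (\<Union>a\<in>S. orbit G (conj_act G) a)"

definition dehn_group :: "('g, 'm) monoid_scheme \<Rightarrow> 'g set \<Rightarrow> 'g word set monoid" where
  "dehn_group G S = adjoint_group G (dehn_quandle G S)"

definition stab_A_eps :: "('g, 'm) monoid_scheme \<Rightarrow> 'g \<Rightarrow> 'g word set monoid" where
  "stab_A_eps G a =
     (let A = adjoint_group G (carrier G)
      in A\<lparr>carrier := stabilizer A (adjoint_act G) a \<inter> kernel A integer_group adjoint_eps\<rparr>)"

definition stab_dehn :: "('g, 'm) monoid_scheme \<Rightarrow> 'g set \<Rightarrow> 'g \<Rightarrow> 'g word set monoid" where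
  "stab_dehn G S a =
     (dehn_group G S)\<lparr>carrier := stabilizer (dehn_group G S) (adjoint_act G) a\<rparr>"

definition stab_group :: "('g, 'm) monoid_scheme \<Rightarrow> 'g \<Rightarrow> ('g, 'm) monoid_scheme" where
  "stab_group G a = G\<lparr>carrier := stabilizer G (conj_act G) a\<rparr>"


section \<open>Presentations with conjugation and power relations\<close>

text \<open>\<open>(a, b, c) \<in> C\<close> encodes the relation \<open>b\<inverse> a b = c\<close>, and \<open>(a, k) \<in> P\<close> the relation
  \<open>a\<^sup>k = 1\<close>. The elements of \<open>\<Gamma>\<close> are formal symbols, and \<open>\<iota>\<close> sends them to the elements of \<open>G\<close>
  they represent; it is not assumed to be injective.\<close>

definition Cbar_relations ::
    "('x \<times> 'x \<times> 'x) set \<Rightarrow> ('x \<times> nat) set \<Rightarrow> ('x word \<times> 'x word) set" where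
  "Cbar_relations C P =
     {([(b, False), (a, True), (b, True)], [(c, True)]) | a b c. (a, b, c) \<in> C} \<union>
     {(replicate k (a, True), []) | a k. (a, k) \<in> P}"

definition Cbar_presentation ::
    "('g, 'm) monoid_scheme \<Rightarrow> 'x set \<Rightarrow> ('x \<times> 'x \<times> 'x) set \<Rightarrow> ('x \<times> nat) set \<Rightarrow> ('x \<Rightarrow> 'g) \<Rightarrow> bool"
  where
  "Cbar_presentation G \<Gamma> C P \<iota> \<longleftrightarrow>
     group G \<and> C \<subseteq> \<Gamma> \<times> \<Gamma> \<times> \<Gamma> \<and> P \<subseteq> \<Gamma> \<times> {2..} \<and>
     (\<exists>\<phi> \<in> iso (presented_group \<Gamma> (Cbar_relations C P)) G.
        \<forall>x\<in>\<Gamma>. \<phi> (pres_gen \<Gamma> (Cbar_relations C P) x) = \<iota> x) \<and>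
     (\<forall>\<O> \<in> conj_classes G. \<exists>\<^sub>\<le>\<^sub>1 p. p \<in> P \<and> \<iota> (fst p) \<in> \<O>)"

definition classes_ng :: "('g, 'm) monoid_scheme \<Rightarrow> 'g set \<Rightarrow> 'g set set" where
  "classes_ng G S = {\<O> \<in> conj_classes G. \<O> \<inter> S = {}}"

text \<open>\<open>group.ord\<close> is \<open>0\<close> on elements of infinite order.\<close>

definition classes_fg :: "('g, 'm) monoid_scheme \<Rightarrow> 'g set \<Rightarrow> 'g set set" where
  "classes_fg G S = {\<O> \<in> conj_classes G. \<O> \<inter> S \<noteq> {} \<and> (\<forall>b\<in>\<O>. group.ord G b > 0)}"

definition class_order :: "('g, 'm) monoid_scheme \<Rightarrow> 'g set \<Rightarrow> nat" where
  "class_order G \<O> = the_elem (group.ord G ` \<O>)"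


section \<open>Abelianisation and short exact sequences\<close>

definition abelianisation :: "('a, 'm) monoid_scheme \<Rightarrow> 'a set monoid" where
  "abelianisation H = H Mod derived H (carrier H)"

definition ab_proj :: "('a, 'm) monoid_scheme \<Rightarrow> 'a \<Rightarrow> 'a set" where
  "ab_proj H x = derived H (carrier H) #>\<^bsub>H\<^esub> x"

text \<open>The map \<open>H\<^sub>A\<^sub>b \<Rightarrow> K\<^sub>A\<^sub>b\<close> induced by a homomorphism \<open>h\<close> from \<open>H\<close> to \<open>K\<close>.\<close>

definition ab_map :: "('b, 'm) monoid_scheme \<Rightarrow> ('a \<Rightarrow> 'b) \<Rightarrow> 'a set \<Rightarrow> 'b set" where
  "ab_map K h U = the_elem ((\<lambda>x. ab_proj K (h x)) ` U)"

text \<open>The library's \<open>short_exact_sequence\<close> forces all groups to have the same element type.\<close>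

definition short_exact ::
    "('a, 'k) monoid_scheme \<Rightarrow> ('b, 'm) monoid_scheme \<Rightarrow> ('c, 'n) monoid_scheme \<Rightarrow>
     ('a \<Rightarrow> 'b) \<Rightarrow> ('b \<Rightarrow> 'c) \<Rightarrow> bool" where
  "short_exact A B C f g \<longleftrightarrow>
     group A \<and> group B \<and> group C \<and>
     f \<in> mon A B \<and> g \<in> epi B C \<and> f ` carrier A = kernel B C g"


section \<open>Basic facts\<close>

lemma word_equiv_words:
  assumes "word_equiv X R u v"
  shows "u \<in> words X \<and> v \<in> words X"
  using assms by induction (auto simp: words_def)

lemma equiv_word_rel: "equiv (words X) (word_rel X R)"
proof (rule equivI)
  show "word_rel X R \<subseteq> words X \<times> words X"
    using word_equiv_words by (fastforce simp: word_rel_def)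
  show "refl_on (words X) (word_rel X R)"
    by (simp add: refl_on_def word_rel_def word_equiv.refl)
  show "sym (word_rel X R)"
    unfolding sym_def word_rel_def using word_equiv.sym by fast
  show "trans (word_rel X R)"
    unfolding trans_def word_rel_def using word_equiv.trans by fast
qed

lemma word_class_eq_iff:
  assumes "u \<in> words X" "v \<in> words X"
  shows "word_rel X R `` {u} = word_rel X R `` {v} \<longleftrightarrow> word_equiv X R u v"
  using eq_equiv_class_iff[OF equiv_word_rel assms] by (simp add: word_rel_def)

lemma presented_group_carrierE:
  assumes "U \<in> carrier (presented_group X R)"
  obtains u where "u \<in> words X" "U = word_rel X R `` {u}"
  using assms by (auto simp: presented_group_def elim: quotientE)

lemma presented_group_carrierI:
  "u \<in> words X \<Longrightarrow> word_rel X R `` {u} \<in> carrier (presented_group X R)"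
  by (simp add: presented_group_def quotientI)

lemma presented_group_mult:
  assumes u: "u \<in> words X" and v: "v \<in> words X"
  shows "word_rel X R `` {u} \<otimes>\<^bsub>presented_group X R\<^esub> word_rel X R `` {v} = word_rel X R `` {u @ v}"
proof -
  have uv: "u @ v \<in> words X" using u v by (simp add: words_def)
  have "word_rel X R `` {u' @ v'} = word_rel X R `` {u @ v}"
    if "u' \<in> word_rel X R `` {u}" "v' \<in> word_rel X R `` {v}" for u' v'
  proof -
    have "word_equiv X R (u @ v) (u' @ v')"
      using that by (auto simp: word_rel_def intro: word_equiv.append)
    then show ?thesis
      using word_class_eq_iff word_equiv_words by metis
  qed
  moreover have "u \<in> word_rel X R `` {u}" "v \<in> word_rel X R `` {v}"
    using u v by (auto simp: word_rel_def intro: word_equiv.refl)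
  ultimately have "(\<Union>u'\<in>word_rel X R `` {u}. \<Union>v'\<in>word_rel X R `` {v}. word_rel X R `` {u' @ v'})
      = word_rel X R `` {u @ v}"
    by blast
  then show ?thesis by (simp add: presented_group_def)
qed

lemma presented_group_one: "\<one>\<^bsub>presented_group X R\<^esub> = word_rel X R `` {[]}"
  by (simp add: presented_group_def)

lemma word_equiv_inverse:
  "w \<in> words X \<Longrightarrow> word_equiv X R (rev (map (apsnd Not) w) @ w) []"
proof (induction w)
  case Nil
  then show ?case by (simp add: word_equiv.refl)
next
  case (Cons p w)
  obtain x s where p: "p = (x, s)" by force
  have x: "x \<in> X" and w: "w \<in> words X" using Cons.prems by (auto simp: p words_def)
  let ?w = "rev (map (apsnd Not) w)"
  have w': "?w \<in> words X" using w by (fastforce simp: words_def)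
  have "word_equiv X R ([(x, \<not> s), (x, \<not> \<not> s)] @ w) ([] @ w)"
    using x w by (intro word_equiv.append word_equiv.cancel word_equiv.refl)
  then have "word_equiv X R (?w @ ([(x, \<not> s), (x, \<not> \<not> s)] @ w)) (?w @ ([] @ w))"
    by (rule word_equiv.append[OF word_equiv.refl[OF w']])
  then show ?case using word_equiv.trans[OF _ Cons.IH[OF w]] by (simp add: p)
qed

lemma group_presented_group: "group (presented_group X R)"
proof (rule groupI)
  fix U V W
  assume U: "U \<in> carrier (presented_group X R)" and V: "V \<in> carrier (presented_group X R)"
  obtain u v where uv: "u \<in> words X" "v \<in> words X"
    "U = word_rel X R `` {u}" "V = word_rel X R `` {v}"
    using U V by (metis presented_group_carrierE)
  then show "U \<otimes>\<^bsub>presented_group X R\<^esub> V \<in> carrier (presented_group X R)"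
    using presented_group_carrierI[of "u @ v" X R] by (simp add: presented_group_mult words_def)
  assume W: "W \<in> carrier (presented_group X R)"
  then obtain w where w: "w \<in> words X" "W = word_rel X R `` {w}"
    by (metis presented_group_carrierE)
  have "u @ v \<in> words X" "v @ w \<in> words X" using uv w by (auto simp: words_def)
  then show "U \<otimes>\<^bsub>presented_group X R\<^esub> V \<otimes>\<^bsub>presented_group X R\<^esub> W =
      U \<otimes>\<^bsub>presented_group X R\<^esub> (V \<otimes>\<^bsub>presented_group X R\<^esub> W)"
    using uv w by (simp add: presented_group_mult)
next
  show "\<one>\<^bsub>presented_group X R\<^esub> \<in> carrier (presented_group X R)"
    unfolding presented_group_one by (rule presented_group_carrierI) (simp add: words_def)
next
  fix U assume "U \<in> carrier (presented_group X R)"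
  then obtain u where u: "u \<in> words X" "U = word_rel X R `` {u}"
    by (metis presented_group_carrierE)
  have nil: "[] \<in> words X" by (simp add: words_def)
  show "\<one>\<^bsub>presented_group X R\<^esub> \<otimes>\<^bsub>presented_group X R\<^esub> U = U"
    unfolding presented_group_one u(2) by (simp add: presented_group_mult nil u(1))
  let ?v = "rev (map (apsnd Not) u)"
  have v: "?v \<in> words X" using u(1) by (fastforce simp: words_def)
  have vu: "?v @ u \<in> words X" using u v by (simp add: words_def)
  have "word_rel X R `` {?v} \<otimes>\<^bsub>presented_group X R\<^esub> U = \<one>\<^bsub>presented_group X R\<^esub>"
    unfolding presented_group_one u(2) presented_group_mult[OF v u(1)]
      word_class_eq_iff[OF vu nil] by (rule word_equiv_inverse[OF u(1)])
  then show "\<exists>V\<in>carrier (presented_group X R). V \<otimes>\<^bsub>presented_group X R\<^esub> U = \<one>\<^bsub>presented_group X R\<^esub>"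
    using presented_group_carrierI[OF v] by blast
qed

context group
begin

lemma word_eval_closed:
  assumes "f \<in> X \<rightarrow> carrier G" "w \<in> words X"
  shows "word_eval G f w \<in> carrier G"
  using assms(2)
proof (induction w)
  case Nil
  then show ?case by (simp add: word_eval_def)
next
  case (Cons p w)
  obtain x s where p: "p = (x, s)" by force
  have "x \<in> X" and w: "w \<in> words X" using Cons.prems by (auto simp: p words_def)
  then have "f x \<in> carrier G" using assms(1) by blast
  then show ?case using Cons.IH[OF w] by (simp add: word_eval_def p)
qed

lemma word_eval_append:
  assumes "f \<in> X \<rightarrow> carrier G" "u \<in> words X" "v \<in> words X"
  shows "word_eval G f (u @ v) = word_eval G f u \<otimes> word_eval G f v"
  using assms(2)
proof (induction u)
  case Nil
  then show ?case using word_eval_closed[OF assms(1,3)] by (simp add: word_eval_def)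
next
  case (Cons p u)
  obtain x s where p: "p = (x, s)" by force
  have "x \<in> X" and u: "u \<in> words X" using Cons.prems by (auto simp: p words_def)
  then have "f x \<in> carrier G" using assms(1) by blast
  then show ?case
    using Cons.IH[OF u] word_eval_closed[OF assms(1) u] word_eval_closed[OF assms(1,3)]
    by (simp add: word_eval_def p m_assoc)
qed

lemma word_eval_equiv:
  assumes f: "f \<in> X \<rightarrow> carrier G"
    and R: "\<And>u v. (u, v) \<in> R \<Longrightarrow> u \<in> words X \<Longrightarrow> v \<in> words X \<Longrightarrow> word_eval G f u = word_eval G f v"
    and "word_equiv X R u v"
  shows "word_eval G f u = word_eval G f v"
  using assms(3)
proof induction
  case (append u u' v v')
  have "u \<in> words X" "u' \<in> words X" "v \<in> words X" "v' \<in> words X"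
    using append.hyps word_equiv_words by blast+
  then show ?case using append.IH by (simp add: word_eval_append[OF f])
next
  case (cancel x s)
  then have "f x \<in> carrier G" using f by blast
  then show ?case by (simp add: word_eval_def)
next
  case (relation u v)
  then show ?case by (rule R)
qed simp_all

lemma pres_hom_class:
  assumes f: "f \<in> X \<rightarrow> carrier G"
    and R: "\<And>u v. (u, v) \<in> R \<Longrightarrow> u \<in> words X \<Longrightarrow> v \<in> words X \<Longrightarrow> word_eval G f u = word_eval G f v"
    and u: "u \<in> words X"
  shows "pres_hom G f (word_rel X R `` {u}) = word_eval G f u"
proof -
  have "word_eval G f v = word_eval G f u" if "v \<in> word_rel X R `` {u}" for v
    using word_eval_equiv[where u = u and v = v, OF f R] that by (simp add: word_rel_def)
  moreover have "u \<in> word_rel X R `` {u}"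
    using word_equiv.refl[OF u] by (simp add: word_rel_def)
  ultimately have "word_eval G f ` (word_rel X R `` {u}) = {word_eval G f u}"
    by blast
  then show ?thesis by (simp add: pres_hom_def)
qed

lemma pres_hom_hom:
  assumes f: "f \<in> X \<rightarrow> carrier G"
    and R: "\<And>u v. (u, v) \<in> R \<Longrightarrow> u \<in> words X \<Longrightarrow> v \<in> words X \<Longrightarrow> word_eval G f u = word_eval G f v"
  shows "pres_hom G f \<in> hom (presented_group X R) G"
proof (rule homI)
  fix U assume "U \<in> carrier (presented_group X R)"
  then obtain u where u: "u \<in> words X" "U = word_rel X R `` {u}"
    by (metis presented_group_carrierE)
  then show "pres_hom G f U \<in> carrier G"
    using pres_hom_class[OF f R] word_eval_closed[OF f] by simp
  fix V assume "V \<in> carrier (presented_group X R)"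
  then obtain v where v: "v \<in> words X" "V = word_rel X R `` {v}"
    by (metis presented_group_carrierE)
  have uv: "u @ v \<in> words X" using u v by (simp add: words_def)
  show "pres_hom G f (U \<otimes>\<^bsub>presented_group X R\<^esub> V) = pres_hom G f U \<otimes> pres_hom G f V"
    unfolding u(2) v(2) presented_group_mult[OF u(1) v(1)]
    using pres_hom_class[OF f R uv] pres_hom_class[OF f R u(1)] pres_hom_class[OF f R v(1)]
      word_eval_append[OF f u(1) v(1)] by simp
qed

lemma pres_hom_gen:
  assumes f: "f \<in> X \<rightarrow> carrier G"
    and R: "\<And>u v. (u, v) \<in> R \<Longrightarrow> u \<in> words X \<Longrightarrow> v \<in> words X \<Longrightarrow> word_eval G f u = word_eval G f v"
    and x: "x \<in> X"
  shows "pres_hom G f (pres_gen X R x) = f x"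
proof -
  have "[(x, True)] \<in> words X" "f x \<in> carrier G" using f x by (auto simp: words_def)
  then show ?thesis
    using pres_hom_class[OF f R] by (simp add: pres_gen_def word_eval_def)
qed

lemma conj_op_closed: "a \<in> carrier G \<Longrightarrow> b \<in> carrier G \<Longrightarrow> a \<triangleleft> b \<in> carrier G"
  by (simp add: conj_op_def)

lemma conj_op_mult:
  "a \<in> carrier G \<Longrightarrow> b \<in> carrier G \<Longrightarrow> c \<in> carrier G \<Longrightarrow> a \<triangleleft> (b \<otimes> c) = (a \<triangleleft> b) \<triangleleft> c"
  by (simp add: conj_op_def inv_mult_group m_assoc)

lemma conj_act_Bij:
  assumes b: "b \<in> carrier G"
  shows "conj_act G b \<in> Bij (carrier G)"
proof -
  have "bij_betw (conj_act G b) (carrier G) (carrier G)"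
  proof (rule bij_betw_byWitness[where f' = "conj_act G (inv b)"])
    show "\<forall>a\<in>carrier G. conj_act G (inv b) (conj_act G b a) = a"
      using b by (simp add: conj_act_def conj_op_closed conj_op_mult[symmetric])
        (simp add: conj_op_def)
    show "\<forall>a\<in>carrier G. conj_act G b (conj_act G (inv b) a) = a"
      using b by (simp add: conj_act_def conj_op_closed conj_op_mult[symmetric])
        (simp add: conj_op_def)
  qed (use b in \<open>auto simp: conj_act_def conj_op_closed\<close>)
  then show ?thesis by (simp add: Bij_def conj_act_def)
qed

lemma group_opposite_group: "group (opposite_group G)"
proof (rule groupI)
  fix x assume "x \<in> carrier (opposite_group G)"
  then show "\<exists>y\<in>carrier (opposite_group G). y \<otimes>\<^bsub>opposite_group G\<^esub> x = \<one>\<^bsub>opposite_group G\<^esub>"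
    by (intro bexI[of _ "inv x"]) (simp_all add: opposite_group_def)
qed (simp_all add: opposite_group_def m_assoc)

lemma adjoint_proj_hom:
  assumes "Q \<subseteq> carrier G"
  shows "adjoint_proj G \<in> hom (adjoint_group G Q) G"
  unfolding adjoint_proj_def adjoint_group_def
proof (rule pres_hom_hom)
  show "(\<lambda>a. a) \<in> Q \<rightarrow> carrier G" using assms by blast
next
  fix u v assume "(u, v) \<in> adjoint_relations G Q"
  then obtain a b where ab: "a \<in> carrier G" "b \<in> carrier G"
    "u = [(a, True), (b, True)]" "v = [(b, True), (a \<triangleleft> b, True)]"
    using assms by (auto simp: adjoint_relations_def)
  then show "word_eval G (\<lambda>a. a) u = word_eval G (\<lambda>a. a) v"
    by (simp add: word_eval_def conj_op_def m_assoc[symmetric])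
qed

lemma adjoint_act_respects:
  assumes "Q \<subseteq> carrier G" "(u, v) \<in> adjoint_relations G Q"
  shows "word_eval (opposite_group (BijGroup (carrier G))) (conj_act G) u =
         word_eval (opposite_group (BijGroup (carrier G))) (conj_act G) v"
proof -
  interpret B: group "BijGroup (carrier G)" by (rule group_BijGroup)
  interpret O: group "opposite_group (BijGroup (carrier G))" by (rule B.group_opposite_group)
  obtain a b where ab: "a \<in> carrier G" "b \<in> carrier G"
    "u = [(a, True), (b, True)]" "v = [(b, True), (a \<triangleleft> b, True)]"
    using assms by (auto simp: adjoint_relations_def)
  note cl = conj_act_Bij[OF ab(1)] conj_act_Bij[OF ab(2)] conj_act_Bij[OF conj_op_closed[OF ab(1,2)]]
  have car: "carrier (opposite_group (BijGroup (carrier G))) = Bij (carrier G)"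
    by (simp add: opposite_group_def BijGroup_def)
  have m: "x \<otimes>\<^bsub>opposite_group (BijGroup (carrier G))\<^esub> y = compose (carrier G) y x"
    if "x \<in> Bij (carrier G)" "y \<in> Bij (carrier G)" for x y
    using that by (simp add: opposite_group_def BijGroup_def)
  have "compose (carrier G) (conj_act G b) (conj_act G a) =
        compose (carrier G) (conj_act G (a \<triangleleft> b)) (conj_act G b)"
  proof (rule extensionalityI[of _ "carrier G"])
    fix x assume x: "x \<in> carrier G"
    have "a \<otimes> b = b \<otimes> (a \<triangleleft> b)" using ab by (simp add: conj_op_def m_assoc[symmetric])
    then have "(x \<triangleleft> a) \<triangleleft> b = (x \<triangleleft> b) \<triangleleft> (a \<triangleleft> b)"
      using x ab by (simp add: conj_op_mult[symmetric] conj_op_closed)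
    then show "compose (carrier G) (conj_act G b) (conj_act G a) x =
        compose (carrier G) (conj_act G (a \<triangleleft> b)) (conj_act G b) x"
      using x ab by (simp add: compose_def conj_act_def conj_op_closed)
  qed (simp_all add: compose_def)
  then show ?thesis
    using cl O.r_one unfolding car by (simp add: word_eval_def ab m)
qed

lemma adjoint_act_right_action:
  assumes "Q \<subseteq> carrier G"
  shows "adjoint_act G \<in> hom (adjoint_group G Q) (opposite_group (BijGroup (carrier G)))"
    and "b \<in> Q \<Longrightarrow> adjoint_act G (adjoint_gen G Q b) = conj_act G b"
proof -
  interpret B: group "BijGroup (carrier G)" by (rule group_BijGroup)
  interpret O: group "opposite_group (BijGroup (carrier G))" by (rule B.group_opposite_group)
  have f: "conj_act G \<in> Q \<rightarrow> carrier (opposite_group (BijGroup (carrier G)))"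
    using assms conj_act_Bij by (auto simp: opposite_group_def BijGroup_def)
  show "adjoint_act G \<in> hom (adjoint_group G Q) (opposite_group (BijGroup (carrier G)))"
    unfolding adjoint_act_def adjoint_group_def
    by (rule O.pres_hom_hom[OF f]) (rule adjoint_act_respects[OF assms])
  show "adjoint_act G (adjoint_gen G Q b) = conj_act G b" if "b \<in> Q"
    unfolding adjoint_act_def adjoint_gen_def
    by (rule O.pres_hom_gen[OF f _ that]) (rule adjoint_act_respects[OF assms])
qed

lemma adjoint_eps_hom: "adjoint_eps \<in> hom (adjoint_group G Q) integer_group"
  and adjoint_eps_gen: "a \<in> Q \<Longrightarrow> adjoint_eps (adjoint_gen G Q a) = 1"
proof -
  interpret Z: group integer_group by simp
  have R: "word_eval integer_group (\<lambda>a. 1) u = word_eval integer_group (\<lambda>a. 1) v"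
    if uv: "(u, v) \<in> adjoint_relations G Q" for u v
  proof -
    obtain a b where "u = [(a, True), (b, True)]" "v = [(b, True), (a \<triangleleft> b, True)]"
      using uv unfolding adjoint_relations_def by blast
    then show ?thesis by (simp add: word_eval_def)
  qed
  show "adjoint_eps \<in> hom (adjoint_group G Q) integer_group"
    unfolding adjoint_eps_def adjoint_group_def by (rule Z.pres_hom_hom, simp, rule R)
  show "adjoint_eps (adjoint_gen G Q a) = 1" if "a \<in> Q"
    unfolding adjoint_eps_def adjoint_gen_def
    by (rule Z.pres_hom_gen[where f = "\<lambda>a. 1", OF _ _ that], simp, rule R)
qed

end

end

theory Submission
  imports Defs
begin

text \<open>Write \<open>\<pi>\<close> for the projection of an adjoint group to \<open>G\<close>; its kernel is central because
  \<open>x\<inverse> e\<^sub>b x = e\<^bsub>b \<triangleleft> \<pi>(x)\<^esub>\<close>. Sending \<open>e\<^sub>b\<close> to the conjugacy class of \<open>b\<close> defines a homomorphism \<open>cls\<close>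
  from the Dehn group to a free abelian group. The kernel of \<open>\<pi>\<close> on the Dehn group is generated by
  the powers \<open>e\<^sub>b\<^sup>k\<close> coming from the power relations, on which \<open>cls\<close> is injective. This gives the short
  exact sequence, and it shows that \<open>(\<pi>, cls)\<close> is injective on the Dehn group. Hence \<open>\<pi>\<close> has a
  set-theoretic section \<open>lift\<close> that is equivariant under conjugation, extends \<open>b \<mapsto> e\<^sub>b\<close> and maps \<open>1\<close>
  to \<open>1\<close>. It induces a retraction of \<open>A(G)\<close> onto the Dehn group, and the elements
  \<open>e\<^sub>b lift(b)\<inverse>\<close> are central and depend only on the class of \<open>b\<close>; so \<open>A(G)\<close> is the product of the Dehn
  group and the free abelian group on the classes without generators. The factor of the class of
  \<open>1\<close> is generated by \<open>e\<^sub>1\<close>, which has degree 1, and is removed by restricting to degree 0.\<close>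

section \<open>Generators and homomorphisms\<close>

lemma hom_eq_on_generate:
  assumes "group G" "group H" "f \<in> hom G H" "g \<in> hom G H" "S \<subseteq> carrier G"
    and eq: "\<And>x. x \<in> S \<Longrightarrow> f x = g x"
    and "x \<in> generate G S"
  shows "f x = g x"
proof -
  interpret f: group_hom G H f using assms by (simp add: group_hom_def group_hom_axioms_def)
  interpret g: group_hom G H g using assms by (simp add: group_hom_def group_hom_axioms_def)
  from assms(7) show ?thesis
  proof induction
    case (inv h)
    then show ?case using eq \<open>S \<subseteq> carrier G\<close> by (metis f.hom_inv g.hom_inv subsetD)
  next
    case (eng x y)
    then have "x \<in> carrier G" "y \<in> carrier G"
      using f.G.generate_in_carrier[OF \<open>S \<subseteq> carrier G\<close>] by auto
    then show ?case using eng by simp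
  qed (simp_all add: eq)
qed

lemma pres_gen_closed: "x \<in> X \<Longrightarrow> pres_gen X R x \<in> carrier (presented_group X R)"
  unfolding pres_gen_def by (rule presented_group_carrierI) (simp add: words_def)

text \<open>Induction on the word. A letter with sign \<open>False\<close> is handled by the rule
  \<open>cancel\<close>, which makes its class the inverse of the generator. Together with
  \<open>word_eval_in_generate\<close> this shows that the generators generate the presented
  group.\<close>

lemma word_eval_pres_gen:
  "w \<in> words X \<Longrightarrow> word_eval (presented_group X R) (pres_gen X R) w = word_rel X R `` {w}"
proof (induction w)
  case Nil
  then show ?case by (simp add: word_eval_def presented_group_one)
next
  interpret P: group "presented_group X R" by (rule group_presented_group)
  case (Cons p w)
  obtain x s where p: "p = (x, s)" by force
  have x: "x \<in> X" and w: "w \<in> words X" and pw: "[p] \<in> words X"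
    using Cons.prems by (auto simp: p words_def)
  have "inv\<^bsub>presented_group X R\<^esub> pres_gen X R x = word_rel X R `` {[(x, False)]}"
  proof (rule P.inv_equality)
    have ws: "[(x, True)] \<in> words X" "[(x, False)] \<in> words X"
      "[(x, False), (x, True)] \<in> words X" "[] \<in> words X"
      using x by (auto simp: words_def)
    show "word_rel X R `` {[(x, False)]} \<otimes>\<^bsub>presented_group X R\<^esub> pres_gen X R x
        = \<one>\<^bsub>presented_group X R\<^esub>"
      using ws word_equiv.cancel[OF x, of R False]
      by (simp add: pres_gen_def presented_group_one presented_group_mult word_class_eq_iff)
  qed (use x in \<open>auto intro!: presented_group_carrierI pres_gen_closed simp: words_def\<close>)
  then have "(if s then pres_gen X R x else inv\<^bsub>presented_group X R\<^esub> pres_gen X R x) =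
      word_rel X R `` {[p]}"
    by (simp add: p pres_gen_def)
  then show ?case
    using Cons.IH[OF w] presented_group_mult[OF pw w, of R] by (simp add: word_eval_def p)
qed

lemma (in group) word_eval_in_generate:
  "w \<in> words X \<Longrightarrow> word_eval G f w \<in> generate G (f ` X)"
proof (induction w)
  case Nil
  then show ?case by (simp add: word_eval_def generate.one)
next
  case (Cons p w)
  obtain x s where p: "p = (x, s)" by force
  have "f x \<in> f ` X" and w: "w \<in> words X" using Cons.prems by (auto simp: p words_def)
  then have "(if s then f x else inv f x) \<in> generate G (f ` X)"
    by (simp add: generate.incl generate.inv)
  then show ?case using Cons.IH[OF w] by (simp add: word_eval_def p generate.eng)
qed

lemma presented_group_generated:
  "carrier (presented_group X R) = generate (presented_group X R) (pres_gen X R ` X)"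
proof
  interpret P: group "presented_group X R" by (rule group_presented_group)
  show "generate (presented_group X R) (pres_gen X R ` X) \<subseteq> carrier (presented_group X R)"
    by (rule P.generate_incl) (auto simp: pres_gen_closed)
  show "carrier (presented_group X R) \<subseteq> generate (presented_group X R) (pres_gen X R ` X)"
    using P.word_eval_in_generate word_eval_pres_gen by (metis presented_group_carrierE subsetI)
qed

lemma (in group_hom) hom_word_eval:
  assumes f: "f \<in> X \<rightarrow> carrier G" and g: "\<And>x. x \<in> X \<Longrightarrow> h (f x) = g x" and w: "w \<in> words X"
  shows "h (word_eval G f w) = word_eval H g w"
  using w
proof (induction w)
  case Nil
  then show ?case by (simp add: word_eval_def)
next
  case (Cons p w)
  obtain x s where p: "p = (x, s)" by force
  have x: "x \<in> X" and w: "w \<in> words X" using Cons.prems by (auto simp: p words_def)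
  then have "f x \<in> carrier G" using f by blast
  then show ?case
    using Cons.IH[OF w] G.word_eval_closed[OF f w] g[OF x] by (simp add: word_eval_def p)
qed

section \<open>Abelianisations\<close>

context group
begin

lemma comm_group_abelianisation: "comm_group (abelianisation G)"
  unfolding abelianisation_def by (rule derived_quot_is_comm_group)

lemma ab_proj_hom: "ab_proj G \<in> hom G (abelianisation G)"
  using normal.r_coset_hom_Mod[OF derived_self_is_normal]
  by (simp add: ab_proj_def[abs_def] abelianisation_def)

lemma ab_proj_surj: "ab_proj G ` carrier G = carrier (abelianisation G)"
  by (simp add: abelianisation_def carrier_FactGroup ab_proj_def[abs_def])

lemma ab_proj_eq_one_iff:
  assumes "x \<in> carrier G"
  shows "ab_proj G x = \<one>\<^bsub>abelianisation G\<^esub> \<longleftrightarrow> x \<in> derived G (carrier G)"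
proof -
  interpret D: normal "derived G (carrier G)" G by (rule derived_self_is_normal)
  show ?thesis using assms coset_join1 coset_join2
    by (metis D.is_subgroup D.subset ab_proj_def abelianisation_def one_FactGroup)
qed

text \<open>Homomorphisms carry derived subgroups to derived subgroups, and that of a subset of a
  commutative group is trivial.\<close>

lemma derived_subset_kernel:
  assumes "comm_group T" "h \<in> hom G T"
  shows "derived G (carrier G) \<subseteq> kernel G T h"
proof
  interpret T: comm_group T by fact
  interpret h: group_hom G T h
    using assms(2) by (simp add: group_hom_def group_hom_axioms_def is_group T.is_group)
  fix x assume x: "x \<in> derived G (carrier G)"
  then have "h x \<in> derived T (h ` carrier G)" using h.derived_img[of "carrier G"] by auto
  moreover have "derived T (h ` carrier G) = {\<one>\<^bsub>T\<^esub>}"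
    by (rule T.derived_eq_singleton) auto
  ultimately show "x \<in> kernel G T h"
    using derived_in_carrier[of "carrier G"] x by (auto simp: kernel_def)
qed

text \<open>Recognises an abelianisation from a surjection onto a commutative group. Only one
  inclusion between the kernel and the derived subgroup has to be supplied; the other is
  \<open>derived_subset_kernel\<close>.\<close>

lemma abelianisation_isoI:
  assumes "comm_group T" "h \<in> hom G T" "h ` carrier G = carrier T"
    and "kernel G T h \<subseteq> derived G (carrier G)"
  shows "abelianisation G \<cong> T"
proof -
  interpret T: comm_group T by fact
  interpret h: group_hom G T h
    using assms(2) by (simp add: group_hom_def group_hom_axioms_def is_group T.is_group)
  have "kernel G T h = derived G (carrier G)"
    using assms(4) derived_subset_kernel[OF assms(1,2)] by blast
  then show ?thesis using h.FactGroup_iso[OF assms(3)] by (simp add: abelianisation_def)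
qed

end

text \<open>Shows that \<open>the_elem\<close> in \<open>ab_map\<close> is applied to a singleton:
  two elements of a coset differ by an element of the derived subgroup, which
  \<open>ab_proj H \<circ> h\<close> kills because its target is commutative.\<close>

lemma (in group_hom) ab_map_ab_proj:
  assumes x: "x \<in> carrier G"
  shows "ab_map H h (ab_proj G x) = ab_proj H (h x)"
proof -
  interpret D: normal "derived G (carrier G)" G by (rule G.derived_self_is_normal)
  interpret E: group_hom H "abelianisation H" "ab_proj H"
    using H.ab_proj_hom H.comm_group_abelianisation
    by (simp add: group_hom_def group_hom_axioms_def comm_group_def H.is_group)
  have "ab_proj H (h y) = ab_proj H (h x)" if y: "y \<in> ab_proj G x" for y
  proof -
    obtain d where d: "d \<in> derived G (carrier G)" "y = d \<otimes>\<^bsub>G\<^esub> x"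
      using y by (auto simp: ab_proj_def r_coset_def)
    have "ab_proj H \<circ> h \<in> hom G (abelianisation H)"
      by (rule Group.hom_compose[OF homh H.ab_proj_hom])
    then have "ab_proj H (h d) = \<one>\<^bsub>abelianisation H\<^esub>"
      using G.derived_subset_kernel[OF H.comm_group_abelianisation] d(1)
      by (fastforce simp: kernel_def)
    then show ?thesis using d x D.subset E.l_one by auto
  qed
  moreover have "x \<in> ab_proj G x"
    unfolding ab_proj_def by (rule G.rcos_self[OF x D.is_subgroup])
  ultimately have "(\<lambda>y. ab_proj H (h y)) ` ab_proj G x = {ab_proj H (h x)}" by blast
  then show ?thesis by (simp add: ab_map_def)
qed

text \<open>Abelianisation is right exact, so only injectivity on the left is at stake. It is
  guaranteed by a homomorphism \<open>c\<close> to a commutative group that is injective on the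
  image of \<open>\<kappa>\<close>: since \<open>c\<close> kills the derived subgroup, that image
  meets the derived subgroup trivially.\<close>

lemma (in group_hom) short_exact_abelianisation:
  assumes surj: "h ` carrier G = carrier H"
    and F: "group F" and \<kappa>: "\<kappa> \<in> hom F G" and ker: "\<kappa> ` carrier F = kernel G H h"
    and T: "comm_group T" and c: "c \<in> hom G T"
    and inj: "\<And>f. f \<in> carrier F \<Longrightarrow> c (\<kappa> f) = \<one>\<^bsub>T\<^esub> \<Longrightarrow> f = \<one>\<^bsub>F\<^esub>"
  shows "short_exact F (abelianisation G) (abelianisation H) (ab_proj G \<circ> \<kappa>) (ab_map H h)"
proof -
  interpret A: comm_group "abelianisation G" by (rule G.comm_group_abelianisation)
  interpret B: comm_group "abelianisation H" by (rule H.comm_group_abelianisation)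
  interpret p: group_hom G "abelianisation G" "ab_proj G"
    using G.ab_proj_hom by (simp add: group_hom_def group_hom_axioms_def)
  interpret q: group_hom H "abelianisation H" "ab_proj H"
    using H.ab_proj_hom by (simp add: group_hom_def group_hom_axioms_def)
  interpret pk: group_hom F "abelianisation G" "ab_proj G \<circ> \<kappa>"
    using Group.hom_compose[OF \<kappa> G.ab_proj_hom] F by (simp add: group_hom_def group_hom_axioms_def)
  have kc: "\<kappa> f \<in> carrier G" if "f \<in> carrier F" for f using \<kappa> that by (auto simp: hom_def)
  have "f = \<one>\<^bsub>F\<^esub>" if f: "f \<in> carrier F" "(ab_proj G \<circ> \<kappa>) f = \<one>\<^bsub>abelianisation G\<^esub>" for f
  proof -
    have "\<kappa> f \<in> derived G (carrier G)" using f G.ab_proj_eq_one_iff[OF kc] by simp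
    then have "c (\<kappa> f) = \<one>\<^bsub>T\<^esub>" using G.derived_subset_kernel[OF T c] by (auto simp: kernel_def)
    then show ?thesis using inj f by blast
  qed
  then have mon: "ab_proj G \<circ> \<kappa> \<in> mon F (abelianisation G)"
    using pk.homh by (auto simp: mon_def pk.inj_on_one_iff)
  have hom: "ab_map H h \<in> hom (abelianisation G) (abelianisation H)"
  proof (rule homI)
    fix U assume "U \<in> carrier (abelianisation G)"
    then obtain x where x: "x \<in> carrier G" "U = ab_proj G x" using G.ab_proj_surj by blast
    then show "ab_map H h U \<in> carrier (abelianisation H)" by (simp add: ab_map_ab_proj)
    fix V assume "V \<in> carrier (abelianisation G)"
    then obtain y where y: "y \<in> carrier G" "V = ab_proj G y" using G.ab_proj_surj by blast
    show "ab_map H h (U \<otimes>\<^bsub>abelianisation G\<^esub> V) =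
        ab_map H h U \<otimes>\<^bsub>abelianisation H\<^esub> ab_map H h V"
      using x y by (simp add: ab_map_ab_proj flip: p.hom_mult q.hom_mult hom_mult)
  qed
  have "ab_map H h ` carrier (abelianisation G) = ab_proj H ` (h ` carrier G)"
    unfolding G.ab_proj_surj[symmetric] image_image by (rule image_cong) (simp_all add: ab_map_ab_proj)
  then have epi: "ab_map H h \<in> epi (abelianisation G) (abelianisation H)"
    using hom by (simp add: epi_def surj H.ab_proj_surj)
  have "U \<in> (ab_proj G \<circ> \<kappa>) ` carrier F"
    if U: "U \<in> kernel (abelianisation G) (abelianisation H) (ab_map H h)" for U
  proof -
    obtain x where x: "x \<in> carrier G" "U = ab_proj G x"
      using U unfolding kernel_def G.ab_proj_surj[symmetric] by blast
    have "h x \<in> derived H (carrier H)"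
      using U x by (simp add: kernel_def ab_map_ab_proj H.ab_proj_eq_one_iff)
    \<comment> \<open>As \<open>h\<close> is onto, it maps the derived subgroup onto the derived
      subgroup. Dividing \<open>x\<close> by a suitable \<open>d\<close> there moves it into the
      kernel of \<open>h\<close> without changing its class in the abelianisation.\<close>
    then have "h x \<in> h ` derived G (carrier G)" using derived_img[of "carrier G"] surj by simp
    then obtain d where d: "d \<in> derived G (carrier G)" "h x = h d" by blast
    have dc: "d \<in> carrier G" using d G.derived_in_carrier[of "carrier G"] by blast
    then have "inv\<^bsub>G\<^esub> d \<otimes>\<^bsub>G\<^esub> x \<in> kernel G H h" using x d by (simp add: kernel_def)
    then obtain f where f: "f \<in> carrier F" "\<kappa> f = inv\<^bsub>G\<^esub> d \<otimes>\<^bsub>G\<^esub> x" using ker by (metis imageE)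
    have "ab_proj G d = \<one>\<^bsub>abelianisation G\<^esub>" using G.ab_proj_eq_one_iff[OF dc] d by simp
    then have "(ab_proj G \<circ> \<kappa>) f = U" using f x dc by simp
    then show ?thesis using f by blast
  qed
  moreover have "(ab_proj G \<circ> \<kappa>) f \<in> kernel (abelianisation G) (abelianisation H) (ab_map H h)"
    if f: "f \<in> carrier F" for f
  proof -
    have "h (\<kappa> f) = \<one>\<^bsub>H\<^esub>" using f ker by (auto simp: kernel_def)
    then show ?thesis using kc[OF f] by (simp add: kernel_def ab_map_ab_proj)
  qed
  ultimately have "(ab_proj G \<circ> \<kappa>) ` carrier F =
      kernel (abelianisation G) (abelianisation H) (ab_map H h)" by blast
  then show ?thesis
    using mon epi F by (simp add: short_exact_def)
qed

section \<open>Conjugacy classes\<close>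

abbreviation conj_class :: "('g, 'm) monoid_scheme \<Rightarrow> 'g \<Rightarrow> 'g set" where
  "conj_class G \<equiv> orbit G (conj_act G)"

context group
begin

lemma conj_op_one [simp]: "b \<in> carrier G \<Longrightarrow> \<one> \<triangleleft> b = \<one>" "a \<in> carrier G \<Longrightarrow> a \<triangleleft> \<one> = a"
  by (simp_all add: conj_op_def)

lemma conj_op_inv_cancel [simp]:
  "a \<in> carrier G \<Longrightarrow> b \<in> carrier G \<Longrightarrow> (a \<triangleleft> b) \<triangleleft> inv b = a"
  by (simp flip: conj_op_mult)

lemma mult_conj_op: "a \<in> carrier G \<Longrightarrow> b \<in> carrier G \<Longrightarrow> b \<otimes> (a \<triangleleft> b) = a \<otimes> b"
  by (simp add: conj_op_def flip: m_assoc)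

lemma conj_op_distrib:
  assumes "x \<in> carrier G" "y \<in> carrier G" "b \<in> carrier G"
  shows "(x \<otimes> y) \<triangleleft> b = (x \<triangleleft> b) \<otimes> (y \<triangleleft> b)"
proof -
  have "b \<otimes> (inv b \<otimes> z) = z" if "z \<in> carrier G" for z
    using that assms by (simp flip: m_assoc)
  then show ?thesis using assms by (simp add: conj_op_def m_assoc)
qed

lemma conj_op_nat_pow:
  "a \<in> carrier G \<Longrightarrow> b \<in> carrier G \<Longrightarrow> (a \<triangleleft> b) [^] (n::nat) = (a [^] n) \<triangleleft> b"
  by (induction n) (simp_all add: conj_op_distrib)

lemma ord_conj_op: "a \<in> carrier G \<Longrightarrow> b \<in> carrier G \<Longrightarrow> ord (a \<triangleleft> b) = ord a"
proof -
  assume a: "a \<in> carrier G" and b: "b \<in> carrier G"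
  have "x \<triangleleft> b = \<one> \<longleftrightarrow> x = \<one>" if "x \<in> carrier G" for x
    using that b conj_op_inv_cancel[of x b] by fastforce
  then have "(a \<triangleleft> b) [^] n = \<one> \<longleftrightarrow> ord a dvd n" for n :: nat
    using a b pow_eq_id[OF a, of n] by (simp add: conj_op_nat_pow)
  then show ?thesis using a b by (subst ord_unique) (auto simp: conj_op_closed)
qed

lemma conj_class_eq: "a \<in> carrier G \<Longrightarrow> conj_class G a = (\<lambda>b. a \<triangleleft> b) ` carrier G"
  by (auto simp: orbit_def conj_act_def)

lemma conj_class_self: "a \<in> carrier G \<Longrightarrow> a \<in> conj_class G a"
  using conj_op_one(2)[of a] by (auto simp: conj_class_eq intro: rev_image_eqI[of \<one>])

lemma conj_class_conj_op:
  assumes a: "a \<in> carrier G" and b: "b \<in> carrier G"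
  shows "conj_class G (a \<triangleleft> b) = conj_class G a"
proof
  show "conj_class G (a \<triangleleft> b) \<subseteq> conj_class G a"
    using a b by (auto simp: conj_class_eq conj_op_closed simp flip: conj_op_mult)
  have "a \<triangleleft> c = (a \<triangleleft> b) \<triangleleft> (inv b \<otimes> c)" if "c \<in> carrier G" for c
    using a b that by (simp add: conj_op_closed conj_op_mult)
  then show "conj_class G a \<subseteq> conj_class G (a \<triangleleft> b)"
    unfolding conj_class_eq[OF a] conj_class_eq[OF conj_op_closed[OF a b]]
    using b by (blast intro: m_closed inv_closed)
qed

lemma conj_class_in: "a \<in> carrier G \<Longrightarrow> conj_class G a \<in> conj_classes G"
  by (auto simp: conj_classes_def orbits_def)

lemma conj_class_unique:
  assumes "\<O> \<in> conj_classes G" "b \<in> \<O>"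
  shows "b \<in> carrier G" "conj_class G b = \<O>"
proof -
  obtain a where a: "a \<in> carrier G" "\<O> = conj_class G a"
    using assms(1) by (auto simp: conj_classes_def orbits_def)
  then obtain c where c: "c \<in> carrier G" "b = a \<triangleleft> c" using assms(2) by (auto simp: conj_class_eq)
  then show "b \<in> carrier G" "conj_class G b = \<O>"
    using a by (simp_all add: conj_op_closed conj_class_conj_op)
qed

lemma conj_classes_nonempty: "\<O> \<in> conj_classes G \<Longrightarrow> \<exists>b. b \<in> \<O>"
  using conj_class_self by (auto simp: conj_classes_def orbits_def)

lemma conj_class_one: "conj_class G \<one> = {\<one>}"
  using one_closed by (auto simp: conj_class_eq)

text \<open>Conjugate elements have equal order, so \<open>the_elem\<close> in
  \<open>class_order\<close> is applied to a singleton.\<close>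

lemma class_order_eq:
  assumes "\<O> \<in> conj_classes G" "b \<in> \<O>"
  shows "class_order G \<O> = ord b"
proof -
  have "\<O> = (\<lambda>c. b \<triangleleft> c) ` carrier G" using conj_class_unique[OF assms] conj_class_eq by metis
  then have "ord ` \<O> = {ord b}"
    using conj_class_unique(1)[OF assms] by (auto simp: image_image ord_conj_op image_constant_conv)
  then show ?thesis by (simp add: class_order_def)
qed

lemma conj_act_hom: "conj_act G \<in> hom G (opposite_group (BijGroup (carrier G)))"
proof (rule homI)
  fix x y assume x: "x \<in> carrier G" and y: "y \<in> carrier G"
  show "conj_act G x \<in> carrier (opposite_group (BijGroup (carrier G)))"
    using conj_act_Bij[OF x] by (simp add: opposite_group_def BijGroup_def)
  show "conj_act G (x \<otimes> y) =
      conj_act G x \<otimes>\<^bsub>opposite_group (BijGroup (carrier G))\<^esub> conj_act G y"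
    using x y conj_act_Bij[OF x] conj_act_Bij[OF y]
    by (auto simp: opposite_group_def BijGroup_def compose_def conj_act_def conj_op_closed
        conj_op_mult fun_eq_iff)
qed

lemma stabilizer_conj_act:
  assumes "a \<in> carrier G"
  shows "stabilizer G (conj_act G) a = {g \<in> carrier G. a \<triangleleft> g = a}"
  using assms by (auto simp: stabilizer_def conj_act_def)

lemma subgroup_stabilizer_conj_act:
  assumes a: "a \<in> carrier G"
  shows "subgroup (stabilizer G (conj_act G) a) G"
  unfolding stabilizer_conj_act[OF a]
proof (rule subgroupI)
  fix g h
  assume g: "g \<in> {g \<in> carrier G. a \<triangleleft> g = a}" and h: "h \<in> {g \<in> carrier G. a \<triangleleft> g = a}"
  show "inv g \<in> {g \<in> carrier G. a \<triangleleft> g = a}" using g a conj_op_inv_cancel[of a g] by auto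
  show "g \<otimes> h \<in> {g \<in> carrier G. a \<triangleleft> g = a}" using g h a by (auto simp: conj_op_mult)
qed (use a in auto)

end

section \<open>Adjoint groups of conjugation-closed subsets\<close>

text \<open>A common setting for both adjoint groups. It is interpreted below with the Dehn quandle,
  under the prefix \<open>D\<close>, and with the whole of \<open>carrier G\<close>, under the
  prefix \<open>U\<close>.\<close>

locale conj_closed_subset = group G for G (structure) +
  fixes Q :: "'a set"
  assumes Q_sub: "Q \<subseteq> carrier G"
    and Q_closed: "a \<in> Q \<Longrightarrow> b \<in> carrier G \<Longrightarrow> a \<triangleleft> b \<in> Q"
begin

abbreviation "A \<equiv> adjoint_group G Q"
abbreviation "e \<equiv> adjoint_gen G Q"
abbreviation "\<pi> \<equiv> adjoint_proj G"

lemma group_A: "group A"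
  unfolding adjoint_group_def by (rule group_presented_group)

sublocale A: group A by (rule group_A)

lemma e_closed [simp]: "a \<in> Q \<Longrightarrow> e a \<in> carrier A"
  unfolding adjoint_group_def adjoint_gen_def by (rule pres_gen_closed)

lemma A_generated: "carrier A = generate A (e ` Q)"
  using presented_group_generated[of Q "adjoint_relations G Q"]
  by (simp add: adjoint_group_def adjoint_gen_def image_def)

lemma e_mult:
  assumes "a \<in> Q" "b \<in> Q"
  shows "e a \<otimes>\<^bsub>A\<^esub> e b = e b \<otimes>\<^bsub>A\<^esub> e (a \<triangleleft> b)"
proof -
  have c: "a \<triangleleft> b \<in> Q" using assms Q_closed Q_sub by blast
  have w: "[(x, True)] \<in> words Q" "[(x, True), (y, True)] \<in> words Q" if "x \<in> Q" "y \<in> Q" for x y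
    using that by (auto simp: words_def)
  have "word_equiv Q (adjoint_relations G Q) [(a, True), (b, True)] [(b, True), (a \<triangleleft> b, True)]"
    by (rule word_equiv.relation) (use assms c w in \<open>auto simp: adjoint_relations_def\<close>)
  then show ?thesis
    using assms c w
    by (simp add: adjoint_group_def adjoint_gen_def pres_gen_def presented_group_mult word_class_eq_iff)
qed

lemma hom_eqI:
  assumes "group H" "f \<in> hom A H" "g \<in> hom A H" "\<And>a. a \<in> Q \<Longrightarrow> f (e a) = g (e a)"
    and "x \<in> carrier A"
  shows "f x = g x"
proof (rule hom_eq_on_generate[OF group_A assms(1-3)])
  show "x \<in> generate A (e ` Q)" using assms(5) by (simp only: A_generated)
qed (use assms(4) in auto)

lemma universal:
  assumes "group H" "f \<in> Q \<rightarrow> carrier H"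
    and "\<And>a b. a \<in> Q \<Longrightarrow> b \<in> Q \<Longrightarrow> f a \<otimes>\<^bsub>H\<^esub> f b = f b \<otimes>\<^bsub>H\<^esub> f (a \<triangleleft> b)"
  shows "pres_hom H f \<in> hom A H" and "a \<in> Q \<Longrightarrow> pres_hom H f (e a) = f a"
proof -
  interpret H: group H by fact
  have R: "word_eval H f u = word_eval H f v" if uv: "(u, v) \<in> adjoint_relations G Q" for u v
  proof -
    obtain a b where ab: "a \<in> Q" "b \<in> Q" "u = [(a, True), (b, True)]" "v = [(b, True), (a \<triangleleft> b, True)]"
      using uv unfolding adjoint_relations_def by blast
    then have "f a \<in> carrier H" "f b \<in> carrier H" "f (a \<triangleleft> b) \<in> carrier H"
      using assms(2) Q_closed[of a b] Q_sub by auto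
    then show ?thesis using assms(3)[OF ab(1,2)] ab by (simp add: word_eval_def)
  qed
  show "pres_hom H f \<in> hom A H"
    unfolding adjoint_group_def by (rule H.pres_hom_hom[OF assms(2) R])
  show "pres_hom H f (e a) = f a" if "a \<in> Q"
    unfolding adjoint_gen_def by (rule H.pres_hom_gen[OF assms(2) R that])
qed

text \<open>In a commutative group the defining relation reads
  \<open>f a = f (a \<triangleleft> b)\<close>, so every function of the conjugacy class extends to
  the adjoint group. The maps \<open>cls\<close>, \<open>\<sigma>\<close> and \<open>\<nu>\<close>
  all arise in this way.\<close>

lemma class_function_hom:
  assumes "comm_group H" "\<And>a. a \<in> Q \<Longrightarrow> f (conj_class G a) \<in> carrier H"
  shows "pres_hom H (\<lambda>a. f (conj_class G a)) \<in> hom A H"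
    and "a \<in> Q \<Longrightarrow> pres_hom H (\<lambda>a. f (conj_class G a)) (e a) = f (conj_class G a)"
proof -
  interpret H: comm_group H by fact
  have comm: "f (conj_class G a) \<otimes>\<^bsub>H\<^esub> f (conj_class G b) =
      f (conj_class G b) \<otimes>\<^bsub>H\<^esub> f (conj_class G (a \<triangleleft> b))" if "a \<in> Q" "b \<in> Q" for a b
    using that Q_sub assms(2) by (subst conj_class_conj_op) (auto intro: H.m_comm)
  have f: "(\<lambda>a. f (conj_class G a)) \<in> Q \<rightarrow> carrier H" using assms(2) by blast
  show "pres_hom H (\<lambda>a. f (conj_class G a)) \<in> hom A H"
    by (rule universal(1)[OF H.is_group f comm])
  show "pres_hom H (\<lambda>a. f (conj_class G a)) (e a) = f (conj_class G a)" if "a \<in> Q"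
    by (rule universal(2)[OF H.is_group f comm that])
qed

abbreviation "cls \<equiv> pres_hom (free_Abelian_group (conj_classes G)) (\<lambda>a. frag_of (conj_class G a))"

lemma cls_hom: "cls \<in> hom A (free_Abelian_group (conj_classes G))"
  and cls_e: "a \<in> Q \<Longrightarrow> cls (e a) = frag_of (conj_class G a)"
  using class_function_hom[OF abelian_free_Abelian_group[of "conj_classes G"], of frag_of]
    conj_class_in Q_sub by auto

lemma \<pi>_hom: "\<pi> \<in> hom A G"
  by (rule adjoint_proj_hom[OF Q_sub])

sublocale \<pi>: group_hom A G \<pi>
  by (simp add: group_hom_def group_hom_axioms_def group_A \<pi>_hom is_group)

lemma \<pi>_e [simp]: "a \<in> Q \<Longrightarrow> \<pi> (e a) = a"
proof -
  assume a: "a \<in> Q"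
  have R: "word_eval G (\<lambda>a. a) u = word_eval G (\<lambda>a. a) v" if uv: "(u, v) \<in> adjoint_relations G Q" for u v
  proof -
    obtain a b where ab: "a \<in> Q" "b \<in> Q"
      "u = [(a, True), (b, True)]" "v = [(b, True), (a \<triangleleft> b, True)]"
      using uv unfolding adjoint_relations_def by blast
    then have "a \<in> carrier G" "b \<in> carrier G" using Q_sub by auto
    then show ?thesis
      using ab by (simp add: word_eval_def mult_conj_op conj_op_closed)
  qed
  show ?thesis
    unfolding adjoint_proj_def adjoint_gen_def
    by (rule pres_hom_gen[OF _ R a]) (use Q_sub in auto)
qed

text \<open>Both sides are homomorphisms in \<open>x\<close> that agree on the generators, so the
  adjoint group acts through \<open>\<pi>\<close>. Its stabilisers are therefore the full preimages
  of the stabilisers in \<open>G\<close>.\<close>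

lemma adjoint_act_eq: "x \<in> carrier A \<Longrightarrow> adjoint_act G x = conj_act G (\<pi> x)"
proof -
  assume x: "x \<in> carrier A"
  have B: "group (opposite_group (BijGroup (carrier G)))"
    by (rule group.group_opposite_group[OF group_BijGroup])
  have "adjoint_act G x = (conj_act G \<circ> \<pi>) x"
    by (rule hom_eqI[OF B adjoint_act_right_action(1)[OF Q_sub] _ _ x],
        rule Group.hom_compose[OF \<pi>_hom conj_act_hom])
      (simp add: adjoint_act_right_action(2)[OF Q_sub])
  then show ?thesis by simp
qed

lemma stabilizer_adjoint_act:
  assumes "a \<in> carrier G"
  shows "stabilizer A (adjoint_act G) a = {x \<in> carrier A. a \<triangleleft> \<pi> x = a}"
  using assms by (auto simp: stabilizer_def adjoint_act_eq conj_act_def)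

lemma subgroup_stabilizer_adjoint_act:
  assumes a: "a \<in> carrier G"
  shows "subgroup (stabilizer A (adjoint_act G) a) A"
  unfolding stabilizer_adjoint_act[OF a]
proof (rule A.subgroupI)
  fix g h
  assume g: "g \<in> {x \<in> carrier A. a \<triangleleft> \<pi> x = a}" and h: "h \<in> {x \<in> carrier A. a \<triangleleft> \<pi> x = a}"
  show "inv\<^bsub>A\<^esub> g \<in> {x \<in> carrier A. a \<triangleleft> \<pi> x = a}" using g a conj_op_inv_cancel[of a "\<pi> g"] by auto
  show "g \<otimes>\<^bsub>A\<^esub> h \<in> {x \<in> carrier A. a \<triangleleft> \<pi> x = a}" using g h a by (auto simp: conj_op_mult)
next
  show "{x \<in> carrier A. a \<triangleleft> \<pi> x = a} \<noteq> {}" using a by (auto intro: exI[of _ "\<one>\<^bsub>A\<^esub>"])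
qed auto

text \<open>For a generator \<open>x\<close> this is the defining relation. Both sides are right
  actions in \<open>x\<close>, so the formula passes to products and inverses.\<close>

lemma e_conj: "x \<in> carrier A \<Longrightarrow> b \<in> Q \<Longrightarrow> e b \<triangleleft>\<^bsub>A\<^esub> x = e (b \<triangleleft> \<pi> x)"
proof -
  assume x: "x \<in> carrier A" and b: "b \<in> Q"
  have gen: "e b \<triangleleft>\<^bsub>A\<^esub> e a = e (b \<triangleleft> a)" if "a \<in> Q" "b \<in> Q" for a b
  proof -
    have c: "b \<triangleleft> a \<in> Q" using that Q_sub Q_closed by blast
    have "e b \<triangleleft>\<^bsub>A\<^esub> e a = inv\<^bsub>A\<^esub> e a \<otimes>\<^bsub>A\<^esub> (e a \<otimes>\<^bsub>A\<^esub> e (b \<triangleleft> a))"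
      using that e_mult[of b a] by (simp add: conj_op_def[of A] A.m_assoc)
    also have "\<dots> = e (b \<triangleleft> a)" using that c by (simp flip: A.m_assoc)
    finally show ?thesis .
  qed
  from x have "x \<in> generate A (e ` Q)" by (simp only: A_generated)
  then show ?thesis using b
  proof (induction arbitrary: b)
    case one
    then show ?case using Q_sub by auto
  next
    case (incl h)
    then show ?case using gen by auto
  next
    case (inv h)
    then obtain a where a: "a \<in> Q" "h = e a" by blast
    have c: "a \<in> carrier G" "b \<in> carrier G" using a inv Q_sub by auto
    \<comment> \<open>The case of an inverse is obtained by applying the generator case to
      \<open>b \<triangleleft> inv a\<close>, the element that conjugation by \<open>a\<close>
      carries to \<open>b\<close>.\<close>
    have b': "b \<triangleleft> inv a \<in> Q" using inv c Q_closed by auto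
    have "(b \<triangleleft> inv a) \<triangleleft> a = b" using conj_op_inv_cancel[of b "inv a"] c by simp
    then have "e b = e (b \<triangleleft> inv a) \<triangleleft>\<^bsub>A\<^esub> e a" using gen[OF a(1) b'] by simp
    then have "e b \<triangleleft>\<^bsub>A\<^esub> inv\<^bsub>A\<^esub> e a = e (b \<triangleleft> inv a)" using a(1) b' by simp
    then show ?case using a by simp
  next
    case (eng x y)
    have xy: "x \<in> carrier A" "y \<in> carrier A" using eng.hyps A_generated by auto
    then have "b \<triangleleft> \<pi> x \<in> Q" using eng Q_closed by auto
    then have "(e b \<triangleleft>\<^bsub>A\<^esub> x) \<triangleleft>\<^bsub>A\<^esub> y = e ((b \<triangleleft> \<pi> x) \<triangleleft> \<pi> y)" using eng by simp
    then show ?case using xy eng.prems Q_sub by (simp add: A.conj_op_mult conj_op_mult subset_iff)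
  qed
qed

text \<open>By \<open>e_conj\<close>, conjugation by \<open>z\<close> is an endomorphism that fixes
  every generator, hence the identity.\<close>

lemma kernel_central:
  assumes z: "z \<in> kernel A G \<pi>" and x: "x \<in> carrier A"
  shows "z \<otimes>\<^bsub>A\<^esub> x = x \<otimes>\<^bsub>A\<^esub> z"
proof -
  have zc: "z \<in> carrier A" and z1: "\<pi> z = \<one>" using z by (auto simp: kernel_def)
  have e: "e b \<triangleleft>\<^bsub>A\<^esub> z = e b" if "b \<in> Q" for b
    using e_conj[OF zc that] z1 that Q_sub by auto
  have "x \<triangleleft>\<^bsub>A\<^esub> z = x"
  proof (rule hom_eqI[OF group_A _ _ _ x])
    show "(\<lambda>x. x \<triangleleft>\<^bsub>A\<^esub> z) \<in> hom A A"
      using zc by (intro homI) (auto simp: A.conj_op_distrib A.conj_op_closed)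
    show "(\<lambda>x. x) \<in> hom A A" by (auto simp: hom_def)
  qed (use e in auto)
  then show ?thesis using A.mult_conj_op[OF x zc] by simp
qed

lemma comm_group_kernel: "comm_group (A\<lparr>carrier := kernel A G \<pi>\<rparr>)"
proof (rule group.group_comm_groupI)
  show "group (A\<lparr>carrier := kernel A G \<pi>\<rparr>)"
    by (rule A.subgroup_imp_group[OF \<pi>.subgroup_kernel])
qed (auto simp: kernel_central kernel_def)

end

section \<open>Groups with a presentation by conjugation and power relations\<close>

lemma (in group) word_eval_replicate:
  "f x \<in> carrier G \<Longrightarrow> word_eval G f (replicate k (x, True)) = f x [^] k"
proof (induction k)
  case (Suc k)
  then show ?case using nat_pow_Suc2[of "f x" k] by (simp add: word_eval_def)
qed (simp add: word_eval_def)

lemma (in comm_group) conj_op_comm: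
  assumes "a \<in> carrier G" "b \<in> carrier G"
  shows "a \<triangleleft> b = a"
  using assms m_comm[of "inv b" a] by (simp add: conj_op_def m_assoc)

locale Cbar_group = group G for G (structure) +
  fixes \<Gamma> :: "'x set" and C :: "('x \<times> 'x \<times> 'x) set" and P :: "('x \<times> nat) set" and \<iota> :: "'x \<Rightarrow> 'a"
  assumes pres: "Cbar_presentation G \<Gamma> C P \<iota>"
begin

abbreviation "S \<equiv> \<iota> ` \<Gamma>"
abbreviation "Q \<equiv> dehn_quandle G S"

lemma C_mem: "(a, b, c) \<in> C \<Longrightarrow> a \<in> \<Gamma> \<and> b \<in> \<Gamma> \<and> c \<in> \<Gamma>"
  and P_mem: "(a, k) \<in> P \<Longrightarrow> a \<in> \<Gamma> \<and> k \<ge> 2"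
  using pres by (auto simp: Cbar_presentation_def)

lemma P_unique:
  assumes "(a, k) \<in> P" "(b, l) \<in> P" "\<O> \<in> conj_classes G" "\<iota> a \<in> \<O>" "\<iota> b \<in> \<O>"
  shows "k = l"
  using pres assms unfolding Cbar_presentation_def Uniq_def by (metis fst_conv snd_conv)

lemma relation_words:
  assumes "(u, v) \<in> Cbar_relations C P"
  shows "u \<in> words \<Gamma>" "v \<in> words \<Gamma>"
  using assms C_mem P_mem by (auto simp: Cbar_relations_def words_def)

lemma presentation_iso:
  obtains \<phi> where "\<phi> \<in> iso (presented_group \<Gamma> (Cbar_relations C P)) G"
    "\<And>x. x \<in> \<Gamma> \<Longrightarrow> \<phi> (pres_gen \<Gamma> (Cbar_relations C P) x) = \<iota> x"
  using pres by (auto simp: Cbar_presentation_def)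

lemma \<iota>_closed [simp]: "x \<in> \<Gamma> \<Longrightarrow> \<iota> x \<in> carrier G"
  using presentation_iso pres_gen_closed[of x \<Gamma> "Cbar_relations C P"]
  by (metis Group.iso_iff hom_in_carrier)

lemma G_generated: "carrier G = generate G S"
proof -
  obtain \<phi> where \<phi>: "\<phi> \<in> iso (presented_group \<Gamma> (Cbar_relations C P)) G"
    "\<And>x. x \<in> \<Gamma> \<Longrightarrow> \<phi> (pres_gen \<Gamma> (Cbar_relations C P) x) = \<iota> x"
    using presentation_iso by blast
  interpret \<phi>: group_hom "presented_group \<Gamma> (Cbar_relations C P)" G \<phi>
    using \<phi>(1) by (simp add: group_hom_def group_hom_axioms_def group_presented_group iso_def is_group)
  let ?g = "pres_gen \<Gamma> (Cbar_relations C P) ` \<Gamma>"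
  have "\<phi> ` ?g = S" using \<phi>(2) by (force simp: image_image)
  moreover have "generate G (\<phi> ` ?g) = \<phi> ` generate (presented_group \<Gamma> (Cbar_relations C P)) ?g"
    by (rule \<phi>.generate_img) (auto simp: pres_gen_closed)
  moreover have "\<dots> = carrier G"
    using \<phi>(1) by (simp add: Group.iso_iff flip: presented_group_generated)
  ultimately show ?thesis by simp
qed

lemma relations_hold:
  assumes uv: "(u, v) \<in> Cbar_relations C P"
  shows "word_eval G \<iota> u = word_eval G \<iota> v"
proof -
  obtain \<phi> where \<phi>: "\<phi> \<in> iso (presented_group \<Gamma> (Cbar_relations C P)) G"
    "\<And>x. x \<in> \<Gamma> \<Longrightarrow> \<phi> (pres_gen \<Gamma> (Cbar_relations C P) x) = \<iota> x"
    using presentation_iso by blast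
  interpret \<phi>: group_hom "presented_group \<Gamma> (Cbar_relations C P)" G \<phi>
    using \<phi>(1) by (simp add: group_hom_def group_hom_axioms_def group_presented_group iso_def is_group)
  note w = relation_words[OF uv]
  have g: "pres_gen \<Gamma> (Cbar_relations C P) \<in> \<Gamma> \<rightarrow> carrier (presented_group \<Gamma> (Cbar_relations C P))"
    by (auto simp: pres_gen_closed)
  have "word_rel \<Gamma> (Cbar_relations C P) `` {u} = word_rel \<Gamma> (Cbar_relations C P) `` {v}"
    using word_class_eq_iff[OF w] word_equiv.relation[OF uv w] by blast
  then show ?thesis
    using \<phi>.hom_word_eval[OF g \<phi>(2) w(1)] \<phi>.hom_word_eval[OF g \<phi>(2) w(2)]
    by (simp add: word_eval_pres_gen w)
qed

lemma conj_relation: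
  assumes "(a, b, c) \<in> C"
  shows "\<iota> a \<triangleleft> \<iota> b = \<iota> c"
proof -
  have "([(b, False), (a, True), (b, True)], [(c, True)]) \<in> Cbar_relations C P"
    using assms by (auto simp: Cbar_relations_def)
  from relations_hold[OF this] show ?thesis
    using C_mem[OF assms] by (simp add: word_eval_def conj_op_def m_assoc)
qed

lemma power_relation:
  assumes "(a, k) \<in> P"
  shows "\<iota> a [^] k = \<one>"
proof -
  have "(replicate k (a, True), []) \<in> Cbar_relations C P"
    using assms by (auto simp: Cbar_relations_def)
  from relations_hold[OF this] show ?thesis
    using P_mem[OF assms] by (simp add: word_eval_replicate) (simp add: word_eval_def)
qed

text \<open>The map out of the presented group, composed with the inverse of the isomorphism to
  \<open>G\<close>; relations between words become equations in \<open>H\<close>.\<close>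

lemma universal_property:
  assumes "group H" and f: "f \<in> \<Gamma> \<rightarrow> carrier H"
    and conj: "\<And>a b c. (a, b, c) \<in> C \<Longrightarrow> f a \<triangleleft>\<^bsub>H\<^esub> f b = f c"
    and pow: "\<And>a k. (a, k) \<in> P \<Longrightarrow> f a [^]\<^bsub>H\<^esub> k = \<one>\<^bsub>H\<^esub>"
  obtains h where "h \<in> hom G H" "\<And>x. x \<in> \<Gamma> \<Longrightarrow> h (\<iota> x) = f x"
proof -
  interpret H: group H by fact
  let ?R = "Cbar_relations C P"
  obtain \<phi> where \<phi>: "\<phi> \<in> iso (presented_group \<Gamma> ?R) G"
    "\<And>x. x \<in> \<Gamma> \<Longrightarrow> \<phi> (pres_gen \<Gamma> ?R x) = \<iota> x"
    using presentation_iso by blast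
  have R: "word_eval H f u = word_eval H f v" if uv: "(u, v) \<in> ?R" for u v
  proof -
    consider (conj) a b c where "(a, b, c) \<in> C" "u = [(b, False), (a, True), (b, True)]" "v = [(c, True)]"
      | (pow) a k where "(a, k) \<in> P" "u = replicate k (a, True)" "v = []"
      using uv by (auto simp: Cbar_relations_def)
    then show ?thesis
    proof cases
      case conj
      then have "f a \<in> carrier H" "f b \<in> carrier H" "f c \<in> carrier H" using C_mem f by auto
      then show ?thesis using assms(3)[OF conj(1)] conj(2,3)
        by (simp add: word_eval_def conj_op_def H.m_assoc)
    next
      case pow
      then have "f a \<in> carrier H" using P_mem f by auto
      then show ?thesis using assms(4)[OF pow(1)] pow(2,3)
        by (simp add: H.word_eval_replicate) (simp add: word_eval_def)
    qed
  qed
  have h: "pres_hom H f \<in> hom (presented_group \<Gamma> ?R) H" by (rule H.pres_hom_hom[OF f R])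
  have "inv_into (carrier (presented_group \<Gamma> ?R)) \<phi> \<in> hom G (presented_group \<Gamma> ?R)"
    using group.iso_set_sym[OF group_presented_group \<phi>(1)] by (simp add: iso_def)
  from Group.hom_compose[OF this h]
  have "pres_hom H f \<circ> inv_into (carrier (presented_group \<Gamma> ?R)) \<phi> \<in> hom G H" .
  moreover have "(pres_hom H f \<circ> inv_into (carrier (presented_group \<Gamma> ?R)) \<phi>) (\<iota> x) = f x"
    if x: "x \<in> \<Gamma>" for x
  proof -
    have "inj_on \<phi> (carrier (presented_group \<Gamma> ?R))" using \<phi>(1) by (simp add: Group.iso_iff)
    then have "inv_into (carrier (presented_group \<Gamma> ?R)) \<phi> (\<iota> x) = pres_gen \<Gamma> ?R x"
      using \<phi>(2)[OF x] pres_gen_closed[OF x, of ?R] by (metis inv_into_f_f)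
    then show ?thesis using H.pres_hom_gen[OF f R x] by simp
  qed
  ultimately show thesis using that by blast
qed

text \<open>The map to a cyclic group that sends the generators in the class of \<open>\<iota> x\<close> to \<open>1\<close> and the
  others to \<open>0\<close> bounds the order of \<open>\<iota> x\<close> from below.\<close>

lemma dvd_exponent:
  assumes x: "x \<in> \<Gamma>" and one: "\<iota> x [^] (n::nat) = \<one>"
    and dvd: "\<And>y m. (y, m) \<in> P \<Longrightarrow> \<iota> y \<in> conj_class G (\<iota> x) \<Longrightarrow> k dvd m"
  shows "k dvd n"
\<comment> \<open>The case \<open>k = 1\<close> is split off because 1 does not lie in the carrier
  of \<open>integer_mod_group 1\<close>. The case \<open>k = 0\<close> stays included:
  \<open>integer_mod_group 0\<close> is the group of integers, and \<open>0 dvd n\<close> says that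
  \<open>n = 0\<close>.\<close>
proof (cases "k = 1")
  case False
  let ?Z = "integer_mod_group k"
  let ?f = "\<lambda>y. if \<iota> y \<in> conj_class G (\<iota> x) then 1 else 0 :: int"
  interpret Z: comm_group ?Z by simp
  have f: "?f y \<in> carrier ?Z" for y using False by simp
  \<comment> \<open>A conjugation relation joins two members of one class, so \<open>?f\<close>
    takes the same value on both, and conjugation is trivial in the commutative target.\<close>
  have "\<iota> c \<in> conj_class G (\<iota> x) \<longleftrightarrow> \<iota> a \<in> conj_class G (\<iota> x)" if "(a, b, c) \<in> C" for a b c
  proof -
    have "conj_class G (\<iota> c) = conj_class G (\<iota> a)"
      using conj_relation[OF that] C_mem[OF that] conj_class_conj_op \<iota>_closed by metis
    then show ?thesis
      using C_mem[OF that] x conj_class_unique(2)[OF conj_class_in] conj_class_self \<iota>_closed by metis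
  qed
  then have conj: "?f a \<triangleleft>\<^bsub>?Z\<^esub> ?f b = ?f c" if "(a, b, c) \<in> C" for a b c
    using that Z.conj_op_comm[OF f f, of a b] by presburger
  \<comment> \<open>A power relation outside the class of \<open>\<iota> x\<close> is sent to a
    multiple of 0; for one inside, the exponent vanishes modulo \<open>k\<close> by the assumption
    \<open>dvd\<close>.\<close>
  have pow: "?f a [^]\<^bsub>?Z\<^esub> m = \<one>\<^bsub>?Z\<^esub>" if "(a, m) \<in> P" for a m
    using dvd[OF that] by (auto simp: mod_eq_0_iff_dvd)
  have F: "?f \<in> \<Gamma> \<rightarrow> carrier ?Z" using f by blast
  obtain h where h: "h \<in> hom G ?Z" "\<And>y. y \<in> \<Gamma> \<Longrightarrow> h (\<iota> y) = ?f y"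
    using universal_property[of ?Z ?f, OF Z.is_group F conj pow] by blast
  interpret h: group_hom G ?Z h
    using h(1) by (simp add: group_hom_def group_hom_axioms_def is_group)
  have "h (\<iota> x) = 1" using h(2)[OF x] conj_class_self x by simp
  then have "h (\<iota> x [^] n) = int n mod int k" using h.hom_nat_pow[of "\<iota> x" n] x by simp
  then show ?thesis using one by (auto simp: mod_eq_0_iff_dvd)
qed simp

text \<open>All power relations in one class have the same exponent \<open>k\<close>, so
  \<open>dvd_exponent\<close> makes \<open>k\<close> divide the order. The relation itself gives the
  converse divisibility.\<close>

lemma ord_eq_power:
  assumes x: "x \<in> \<Gamma>" and y: "(y, k) \<in> P" "\<iota> y \<in> conj_class G (\<iota> x)"
  shows "ord (\<iota> x) = k"
proof -
  have cl: "conj_class G (\<iota> x) \<in> conj_classes G" using x conj_class_in by simp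
  have c: "conj_class G (\<iota> y) = conj_class G (\<iota> x)" by (rule conj_class_unique(2)[OF cl y(2)])
  have "k dvd m" if "(z, m) \<in> P" "\<iota> z \<in> conj_class G (\<iota> x)" for z m
    using P_unique[OF y(1) that(1) cl y(2) that(2)] by simp
  then have "k dvd ord (\<iota> x)"
    using dvd_exponent[OF x pow_ord_eq_1[OF \<iota>_closed[OF x]]] by blast
  moreover have "ord (\<iota> y) dvd k" using power_relation[OF y(1)] P_mem[OF y(1)] pow_eq_id by auto
  moreover have "ord (\<iota> x) = ord (\<iota> y)"
    using class_order_eq[OF cl y(2)] class_order_eq[OF cl conj_class_self[OF \<iota>_closed[OF x]]] by simp
  ultimately show ?thesis using dvd_antisym by metis
qed

text \<open>The case \<open>k = 0\<close> of \<open>dvd_exponent\<close>, whose condition on power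
  relations holds vacuously here.\<close>

lemma ord_eq_zero:
  assumes x: "x \<in> \<Gamma>" and "\<And>y k. (y, k) \<in> P \<Longrightarrow> \<iota> y \<notin> conj_class G (\<iota> x)"
  shows "ord (\<iota> x) = 0"
  using dvd_exponent[OF x pow_ord_eq_1[OF \<iota>_closed[OF x]], of 0] assms(2) by fastforce

text \<open>The order of a generator is either an exponent, hence at least 2, or 0 for infinite
  order; it is never 1. Thus the prescriptions \<open>lift b = D.e b\<close> on \<open>Q\<close> and
  \<open>lift \<one> = \<one>\<close> cannot conflict.\<close>

lemma \<iota>_ne_one:
  assumes x: "x \<in> \<Gamma>" shows "\<iota> x \<noteq> \<one>"
proof
  assume "\<iota> x = \<one>"
  then have "ord (\<iota> x) = 1" by simp
  then show False using ord_eq_power[OF x] ord_eq_zero[OF x] P_mem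
    by (metis One_nat_def Suc_1 not_less_eq_eq order_refl zero_neq_one)
qed

text \<open>A class that contains a generator of finite order must carry a power relation, by
  \<open>ord_eq_zero\<close>. With \<open>power_class_fg\<close> this matches the classes in
  \<open>classes_fg\<close> with those carrying a power relation.\<close>

lemma classes_fgE:
  assumes "\<O> \<in> classes_fg G S"
  obtains x k where "(x, k) \<in> P" "\<iota> x \<in> \<O>" "class_order G \<O> = k"
proof -
  have cl: "\<O> \<in> conj_classes G" and fin: "\<And>b. b \<in> \<O> \<Longrightarrow> ord b > 0"
    using assms by (auto simp: classes_fg_def)
  obtain y where y: "y \<in> \<Gamma>" "\<iota> y \<in> \<O>" using assms by (auto simp: classes_fg_def)
  have "conj_class G (\<iota> y) = \<O>" by (rule conj_class_unique(2)[OF cl y(2)])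
  then obtain x k where "(x, k) \<in> P" "\<iota> x \<in> \<O>"
    using ord_eq_zero[OF y(1)] fin[OF y(2)] by fastforce
  moreover have "class_order G \<O> = k"
    using class_order_eq[OF cl y(2)] ord_eq_power[OF y(1) \<open>(x, k) \<in> P\<close>] \<open>\<iota> x \<in> \<O>\<close>
      \<open>conj_class G (\<iota> y) = \<O>\<close> by simp
  ultimately show thesis using that by blast
qed

lemma power_class_fg:
  assumes "(x, k) \<in> P"
  shows "conj_class G (\<iota> x) \<in> classes_fg G S" "class_order G (conj_class G (\<iota> x)) = k"
proof -
  have x: "x \<in> \<Gamma>" "k \<ge> 2" using P_mem[OF assms] by auto
  have cl: "conj_class G (\<iota> x) \<in> conj_classes G" "\<iota> x \<in> conj_class G (\<iota> x)"
    using x conj_class_in conj_class_self by auto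
  show k: "class_order G (conj_class G (\<iota> x)) = k"
    using class_order_eq[OF cl] ord_eq_power[OF x(1) assms cl(2)] by simp
  have "ord b > 0" if "b \<in> conj_class G (\<iota> x)" for b
    using class_order_eq[OF cl(1) that] k x by simp
  then show "conj_class G (\<iota> x) \<in> classes_fg G S"
    using cl x by (auto simp: classes_fg_def)
qed

lemma class_order_pos: "\<O> \<in> classes_fg G S \<Longrightarrow> class_order G \<O> > 0"
  using classes_fgE P_mem by (metis not_gr0 not_numeral_le_zero)

section \<open>The Dehn quandle of the generators\<close>

lemma Q_iff: "b \<in> carrier G \<Longrightarrow> b \<in> Q \<longleftrightarrow> conj_class G b \<inter> S \<noteq> {}"
proof -
  assume b: "b \<in> carrier G"
  have "b \<in> conj_class G s \<longleftrightarrow> s \<in> conj_class G b" if "s \<in> carrier G" for s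
    using b that conj_class_unique(2)[OF conj_class_in] conj_class_self by metis
  then show ?thesis by (auto simp: dehn_quandle_def)
qed

lemma Q_carrier: "Q \<subseteq> carrier G"
  using conj_class_unique(1)[OF conj_class_in] \<iota>_closed unfolding dehn_quandle_def by blast

lemma S_sub_Q: "S \<subseteq> Q"
  using conj_class_self by (auto simp: dehn_quandle_def)

lemma Q_conj_closed:
  assumes a: "a \<in> Q" and b: "b \<in> carrier G"
  shows "a \<triangleleft> b \<in> Q"
proof -
  have "a \<in> carrier G" using a Q_carrier by blast
  then show ?thesis using a b by (simp add: Q_iff conj_class_conj_op conj_op_closed)
qed

end

sublocale Cbar_group \<subseteq> D: conj_closed_subset G "dehn_quandle G (\<iota> ` \<Gamma>)"
  by unfold_locales (use Q_carrier Q_conj_closed in auto)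

section \<open>The kernel of the projection from the Dehn group\<close>

context Cbar_group
begin

lemma \<iota>_Q [simp]: "x \<in> \<Gamma> \<Longrightarrow> \<iota> x \<in> Q"
  using S_sub_Q by blast

lemma e_S_carrier: "D.e ` S \<subseteq> carrier D.A"
  using S_sub_Q D.e_closed by blast

lemma \<pi>_e_S: "D.\<pi> ` D.e ` S = S"
proof -
  have "D.\<pi> ` D.e ` S = (\<lambda>s. D.\<pi> (D.e s)) ` S" by (rule image_image)
  also have "\<dots> = (\<lambda>s. s) ` S"
  proof (rule image_cong)
    show "D.\<pi> (D.e s) = s" if "s \<in> S" for s by (rule D.\<pi>_e[OF subsetD[OF S_sub_Q that]])
  qed (rule HOL.refl)
  also have "\<dots> = S" by (rule image_ident)
  finally show ?thesis .
qed

lemma \<pi>_generate_S: "D.\<pi> ` generate D.A (D.e ` S) = carrier G"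
  unfolding D.\<pi>.generate_img[OF e_S_carrier, symmetric] \<pi>_e_S by (rule G_generated[symmetric])

text \<open>The subgroup generated by the \<open>D.e s\<close> with \<open>s\<close> in
  \<open>S\<close> already maps onto \<open>G\<close>. Any \<open>b\<close> in \<open>Q\<close> has
  the form \<open>\<iota> x \<triangleleft> g\<close>, and conjugating
  \<open>D.e (\<iota> x)\<close> by a preimage of \<open>g\<close> in this subgroup yields
  \<open>D.e b\<close>.\<close>

lemma D_generated: "carrier D.A = generate D.A (D.e ` S)"
proof
  let ?H = "generate D.A (D.e ` S)"
  have H: "subgroup ?H D.A" by (rule D.A.generate_is_subgroup[OF e_S_carrier])
  show "?H \<subseteq> carrier D.A" by (rule D.A.generate_incl[OF e_S_carrier])
  have "D.e b \<in> ?H" if b: "b \<in> Q" for b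
  proof -
    obtain x where x: "x \<in> \<Gamma>" "b \<in> conj_class G (\<iota> x)" using b unfolding dehn_quandle_def by blast
    then obtain g where g: "g \<in> carrier G" "b = \<iota> x \<triangleleft> g"
      unfolding conj_class_eq[OF \<iota>_closed[OF x(1)]] by blast
    then obtain w where w: "w \<in> ?H" "D.\<pi> w = g" unfolding \<pi>_generate_S[symmetric] by blast
    have xQ: "\<iota> x \<in> Q" using x S_sub_Q by blast
    have "D.e (\<iota> x) \<triangleleft>\<^bsub>D.A\<^esub> w = D.e b"
      using D.e_conj[OF subgroup.mem_carrier[OF H w(1)] xQ] unfolding g(2) w(2) .
    moreover have "D.e (\<iota> x) \<in> ?H" using x(1) by (blast intro: generate.incl)
    ultimately show ?thesis
      using w(1) unfolding conj_op_def[of D.A]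
      by (metis subgroup.m_closed[OF H] subgroup.m_inv_closed[OF H])
  qed
  then have "D.e ` Q \<subseteq> ?H" by blast
  from D.A.generate_subgroup_incl[OF this H] show "carrier D.A \<subseteq> ?H" unfolding D.A_generated .
qed

lemma \<pi>_surj: "D.\<pi> ` carrier D.A = carrier G"
  unfolding D_generated by (rule \<pi>_generate_S)

lemma e_power_kernel:
  assumes "\<O> \<in> classes_fg G S" "b \<in> \<O>"
  shows "b \<in> Q" "D.e b [^]\<^bsub>D.A\<^esub> class_order G \<O> \<in> kernel D.A G D.\<pi>"
proof -
  have cl: "\<O> \<in> conj_classes G" and ne: "\<O> \<inter> S \<noteq> {}" using assms by (auto simp: classes_fg_def)
  show b: "b \<in> Q" using conj_class_unique[OF cl assms(2)] ne Q_iff by simp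
  then show "D.e b [^]\<^bsub>D.A\<^esub> class_order G \<O> \<in> kernel D.A G D.\<pi>"
    using class_order_eq[OF cl assms(2)] conj_class_unique[OF cl assms(2)]
    by (simp add: kernel_def D.\<pi>.hom_nat_pow)
qed

text \<open>A preimage \<open>w\<close> of the conjugating element carries one power to the other by
  conjugation, but the power lies in the central kernel and is fixed.\<close>

lemma e_power_class_invariant:
  assumes "\<O> \<in> classes_fg G S" "b \<in> \<O>" "c \<in> \<O>"
  shows "D.e b [^]\<^bsub>D.A\<^esub> class_order G \<O> = D.e c [^]\<^bsub>D.A\<^esub> class_order G \<O>"
proof -
  have cl: "\<O> \<in> conj_classes G" using assms by (auto simp: classes_fg_def)
  note b = e_power_kernel[OF assms(1,2)]
  have "c \<in> conj_class G b" "b \<in> carrier G" using conj_class_unique[OF cl assms(2)] assms(3) by auto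
  then obtain w where w: "w \<in> carrier D.A" "c = b \<triangleleft> D.\<pi> w"
    unfolding conj_class_eq[OF \<open>b \<in> carrier G\<close>] \<pi>_surj[symmetric] by blast
  have "D.e c [^]\<^bsub>D.A\<^esub> class_order G \<O> = (D.e b [^]\<^bsub>D.A\<^esub> class_order G \<O>) \<triangleleft>\<^bsub>D.A\<^esub> w"
    using D.e_conj[OF w(1) b(1)] w b(1) by (simp flip: D.A.conj_op_nat_pow)
  also have "\<dots> = inv\<^bsub>D.A\<^esub> w \<otimes>\<^bsub>D.A\<^esub> (w \<otimes>\<^bsub>D.A\<^esub> (D.e b [^]\<^bsub>D.A\<^esub> class_order G \<O>))"
    using D.kernel_central[OF b(2) w(1)] w b by (simp add: conj_op_def D.A.m_assoc)
  also have "\<dots> = D.e b [^]\<^bsub>D.A\<^esub> class_order G \<O>"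
    using w b by (simp flip: D.A.m_assoc)
  finally show ?thesis by simp
qed

text \<open>Modulo the central subgroup \<open>N\<close> generated by the powers \<open>e\<^sub>b\<^sup>k\<close>, the defining relations of \<open>G\<close>
  hold in the Dehn group, so \<open>\<pi>\<close> has an inverse modulo \<open>N\<close>.\<close>

lemma kernel_subset:
  assumes N: "N \<lhd> D.A"
    and pow: "\<And>x k. (x, k) \<in> P \<Longrightarrow> D.e (\<iota> x) [^]\<^bsub>D.A\<^esub> k \<in> N"
  shows "kernel D.A G D.\<pi> \<subseteq> N"
proof
  interpret N: normal N D.A by (rule N)
  let ?M = "D.A Mod N"
  let ?q = "\<lambda>x. N #>\<^bsub>D.A\<^esub> x"
  have M: "group ?M" by (rule N.factorgroup_is_group)
  interpret q: group_hom D.A ?M ?q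
    using M N.r_coset_hom_Mod by (simp add: group_hom_def group_hom_axioms_def)
  have eG: "D.e (\<iota> x) \<in> carrier D.A" if "x \<in> \<Gamma>" for x using that S_sub_Q by auto
  have f: "(\<lambda>x. ?q (D.e (\<iota> x))) \<in> \<Gamma> \<rightarrow> carrier ?M" using eG q.hom_closed by blast
  have conj: "?q (D.e (\<iota> a)) \<triangleleft>\<^bsub>?M\<^esub> ?q (D.e (\<iota> b)) = ?q (D.e (\<iota> c))" if abc: "(a, b, c) \<in> C" for a b c
  proof -
    have m: "a \<in> \<Gamma>" "b \<in> \<Gamma>" using C_mem[OF abc] by auto
    have "D.e (\<iota> a) \<triangleleft>\<^bsub>D.A\<^esub> D.e (\<iota> b) = D.e (\<iota> c)"
      using D.e_conj[of "D.e (\<iota> b)" "\<iota> a"] m conj_relation[OF abc] by simp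
    then have "?q (D.e (\<iota> c)) = ?q (inv\<^bsub>D.A\<^esub> D.e (\<iota> b) \<otimes>\<^bsub>D.A\<^esub> D.e (\<iota> a) \<otimes>\<^bsub>D.A\<^esub> D.e (\<iota> b))"
      by (simp add: conj_op_def)
    also have "\<dots> = ?q (D.e (\<iota> a)) \<triangleleft>\<^bsub>?M\<^esub> ?q (D.e (\<iota> b))"
      unfolding conj_op_def using eG[OF m(1)] eG[OF m(2)]
      by (simp only: q.hom_mult q.hom_inv D.A.m_closed D.A.inv_closed)
    finally show ?thesis by simp
  qed
  have pow': "?q (D.e (\<iota> x)) [^]\<^bsub>?M\<^esub> k = \<one>\<^bsub>?M\<^esub>" if "(x, k) \<in> P" for x k
    using P_mem[OF that] pow[OF that] eG
    by (simp only: q.hom_nat_pow[symmetric]) (simp add: N.rcos_const)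
  obtain h where h: "h \<in> hom G ?M" "\<And>x. x \<in> \<Gamma> \<Longrightarrow> h (\<iota> x) = ?q (D.e (\<iota> x))"
    using universal_property[OF M f conj pow'] by blast
  fix z assume z: "z \<in> kernel D.A G D.\<pi>"
  then have zc: "z \<in> carrier D.A" "D.\<pi> z = \<one>" by (auto simp: kernel_def)
  \<comment> \<open>The quotient map factors through \<open>\<pi>\<close> by way of
    \<open>h\<close>, since both maps agree on the generators coming from \<open>S\<close>. Hence it
    kills the kernel of \<open>\<pi>\<close>.\<close>
  have "(h \<circ> D.\<pi>) z = ?q z"
  proof (rule hom_eq_on_generate[OF D.group_A M])
    show "h \<circ> D.\<pi> \<in> hom D.A ?M" by (rule Group.hom_compose[OF D.\<pi>_hom h(1)])
    show "?q \<in> hom D.A ?M" by (rule N.r_coset_hom_Mod)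
    show "z \<in> generate D.A (D.e ` S)" using zc D_generated by simp
    show "D.e ` S \<subseteq> carrier D.A" using eG by blast
    show "(h \<circ> D.\<pi>) y = ?q y" if "y \<in> D.e ` S" for y
      using that h(2) S_sub_Q by auto
  qed
  then have "?q z = N" using zc hom_one[OF h(1) is_group M] by simp
  then show "z \<in> N" by (rule D.A.coset_join1[OF _ zc(1) N.is_subgroup])
qed

text \<open>\<open>\<kappa>\<close> comes from the universal property of the free abelian group, as
  the kernel is commutative. It is injective because \<open>cls \<circ> \<kappa>\<close> is, and
  surjective by \<open>kernel_subset\<close>. The last conjunct is kept because it is the
  injectivity that \<open>short_exact_abelianisation\<close> asks for.\<close>

lemma kernel_iso:
  "\<exists>\<kappa> \<in> iso (free_Abelian_group (classes_fg G S)) (D.A\<lparr>carrier := kernel D.A G D.\<pi>\<rparr>).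
     (\<forall>\<O> \<in> classes_fg G S. \<forall>b \<in> \<O>. \<kappa> (frag_of \<O>) = D.e b [^]\<^bsub>D.A\<^esub> class_order G \<O>) \<and>
     (\<forall>f \<in> carrier (free_Abelian_group (classes_fg G S)). D.cls (\<kappa> f) = 0 \<longrightarrow> f = 0)"
proof -
  let ?F = "free_Abelian_group (classes_fg G S)"
  let ?K = "D.A\<lparr>carrier := kernel D.A G D.\<pi>\<rparr>"
  interpret K: comm_group ?K by (rule D.comm_group_kernel)
  let ?f = "\<lambda>\<O>. D.e (SOME b. b \<in> \<O>) [^]\<^bsub>D.A\<^esub> class_order G \<O>"
  have some: "(SOME b. b \<in> \<O>) \<in> \<O>" if "\<O> \<in> classes_fg G S" for \<O>
    using that by (auto simp: classes_fg_def some_in_eq)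
  have "?f ` classes_fg G S \<subseteq> carrier ?K" using e_power_kernel(2)[OF _ some] by auto
  then obtain \<kappa> where \<kappa>: "\<kappa> \<in> hom ?F ?K" "\<And>\<O>. \<O> \<in> classes_fg G S \<Longrightarrow> \<kappa> (frag_of \<O>) = ?f \<O>"
    using K.free_Abelian_group_universal[of ?f "classes_fg G S"] by blast
  have val: "\<kappa> (frag_of \<O>) = D.e b [^]\<^bsub>D.A\<^esub> class_order G \<O>" if "\<O> \<in> classes_fg G S" "b \<in> \<O>" for \<O> b
    using \<kappa>(2)[OF that(1)] e_power_class_invariant[OF that(1) some[OF that(1)] that(2)] by simp
  have \<kappa>D: "\<kappa> \<in> hom ?F D.A" using \<kappa>(1) by (auto simp: hom_def kernel_def)
  interpret \<kappa>: group_hom ?F D.A \<kappa>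
    using \<kappa>D by (simp add: group_hom_def group_hom_axioms_def)
  interpret c: group_hom D.A "free_Abelian_group (conj_classes G)" D.cls
    using D.cls_hom by (simp add: group_hom_def group_hom_axioms_def)
  have c\<kappa>: "D.cls \<circ> \<kappa> \<in> hom ?F (free_Abelian_group (conj_classes G))"
    by (rule Group.hom_compose[OF \<kappa>D D.cls_hom])
  \<comment> \<open>In coordinates \<open>cls \<circ> \<kappa>\<close> is diagonal with the orders
    of the classes as entries. These are positive on \<open>classes_fg\<close>, so the map is
    injective.\<close>
  have lookup: "Poly_Mapping.lookup (D.cls (\<kappa> f)) \<O> = int (class_order G \<O>) * Poly_Mapping.lookup f \<O>"
    if "Poly_Mapping.keys f \<subseteq> classes_fg G S" for f \<O>
  proof (rule free_Abelian_group_induct[OF that])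
    show "Poly_Mapping.lookup (D.cls (\<kappa> 0)) \<O> = int (class_order G \<O>) * Poly_Mapping.lookup 0 \<O>"
      using \<kappa>.hom_one c.hom_one by simp
  next
    fix f g
    assume "Poly_Mapping.keys f \<subseteq> classes_fg G S" "Poly_Mapping.keys g \<subseteq> classes_fg G S"
      "Poly_Mapping.lookup (D.cls (\<kappa> f)) \<O> = int (class_order G \<O>) * Poly_Mapping.lookup f \<O>"
      "Poly_Mapping.lookup (D.cls (\<kappa> g)) \<O> = int (class_order G \<O>) * Poly_Mapping.lookup g \<O>"
    then show "Poly_Mapping.lookup (D.cls (\<kappa> (f - g))) \<O> =
        int (class_order G \<O>) * Poly_Mapping.lookup (f - g) \<O>"
      using hom_frag_diff[OF c\<kappa>, of f g] by (simp add: lookup_minus right_diff_distrib)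
  next
    fix \<O>' assume \<O>': "\<O>' \<in> classes_fg G S"
    note b = some[OF \<O>'] e_power_kernel(1)[OF \<O>' some[OF \<O>']]
    have "conj_class G (SOME b. b \<in> \<O>') = \<O>'"
      using \<O>' b by (intro conj_class_unique) (auto simp: classes_fg_def)
    then have "D.cls (\<kappa> (frag_of \<O>')) = frag_cmul (int (class_order G \<O>')) (frag_of \<O>')"
      using b \<kappa>(2)[OF \<O>'] by (simp add: c.hom_nat_pow D.cls_e)
    then show "Poly_Mapping.lookup (D.cls (\<kappa> (frag_of \<O>'))) \<O> =
        int (class_order G \<O>) * Poly_Mapping.lookup (frag_of \<O>') \<O>"
      by simp
  qed
  have inj: "f = 0" if f: "f \<in> carrier ?F" "D.cls (\<kappa> f) = 0" for f
  proof (rule poly_mapping_eqI)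
    fix \<O>
    show "Poly_Mapping.lookup f \<O> = Poly_Mapping.lookup 0 \<O>"
    proof (cases "\<O> \<in> classes_fg G S")
      case True
      then show ?thesis using lookup[of f \<O>] f class_order_pos[OF True] by simp
    next
      case False
      then show ?thesis using f by (auto simp: in_keys_iff)
    qed
  qed
  have "\<kappa> ` carrier ?F \<subseteq> kernel D.A G D.\<pi>" using \<kappa>(1) by (auto simp: hom_def)
  \<comment> \<open>The image lies in the kernel of \<open>\<pi>\<close>, hence in the centre, so it
    is normal.\<close>
  then have N: "\<kappa> ` carrier ?F \<lhd> D.A"
  proof (intro D.A.normal_invI)
    show "subgroup (\<kappa> ` carrier ?F) D.A" by (rule \<kappa>.img_is_subgroup)
    fix x h assume x: "x \<in> carrier D.A" and h: "h \<in> \<kappa> ` carrier ?F"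
    then have hk: "h \<in> kernel D.A G D.\<pi>" using \<open>\<kappa> ` carrier ?F \<subseteq> kernel D.A G D.\<pi>\<close> by blast
    then have "h \<in> carrier D.A" by (simp add: kernel_def)
    then have "x \<otimes>\<^bsub>D.A\<^esub> h \<otimes>\<^bsub>D.A\<^esub> inv\<^bsub>D.A\<^esub> x = h"
      using D.kernel_central[OF hk x, symmetric] x by (simp add: D.A.m_assoc)
    then show "x \<otimes>\<^bsub>D.A\<^esub> h \<otimes>\<^bsub>D.A\<^esub> inv\<^bsub>D.A\<^esub> x \<in> \<kappa> ` carrier ?F" using h by simp
  qed
  have "D.e (\<iota> x) [^]\<^bsub>D.A\<^esub> k \<in> \<kappa> ` carrier ?F" if xk: "(x, k) \<in> P" for x k
  proof
    show "D.e (\<iota> x) [^]\<^bsub>D.A\<^esub> k = \<kappa> (frag_of (conj_class G (\<iota> x)))"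
      using val[OF power_class_fg(1)[OF xk] conj_class_self] power_class_fg(2)[OF xk] P_mem[OF xk] by simp
    show "frag_of (conj_class G (\<iota> x)) \<in> carrier ?F" using power_class_fg(1)[OF xk] by simp
  qed
  then have "kernel D.A G D.\<pi> \<subseteq> \<kappa> ` carrier ?F" by (rule kernel_subset[OF N])
  then have "\<kappa> ` carrier ?F = carrier ?K" using \<open>\<kappa> ` carrier ?F \<subseteq> kernel D.A G D.\<pi>\<close> by simp
  moreover have "inj_on \<kappa> (carrier ?F)"
    unfolding \<kappa>.inj_on_one_iff using inj c.hom_one by force
  ultimately have "\<kappa> \<in> iso ?F ?K" using \<kappa>(1) by (simp add: Group.iso_iff)
  then show ?thesis using val inj by blast
qed

text \<open>The quotient of two elements with the same image under \<open>\<pi>\<close> has the form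
  \<open>\<kappa> f\<close>. If \<open>cls\<close> does not distinguish them either, then
  \<open>cls (\<kappa> f) = 0\<close>, which forces \<open>f = 0\<close>.\<close>

lemma \<pi>_cls_injective:
  assumes x: "x \<in> carrier D.A" and y: "y \<in> carrier D.A"
    and eq: "D.\<pi> x = D.\<pi> y" "D.cls x = D.cls y"
  shows "x = y"
proof -
  obtain \<kappa> where \<kappa>:
    "\<kappa> \<in> iso (free_Abelian_group (classes_fg G S)) (D.A\<lparr>carrier := kernel D.A G D.\<pi>\<rparr>)"
    "\<forall>f \<in> carrier (free_Abelian_group (classes_fg G S)). D.cls (\<kappa> f) = 0 \<longrightarrow> f = 0"
    using kernel_iso by blast
  interpret c: group_hom D.A "free_Abelian_group (conj_classes G)" D.cls
    using D.cls_hom by (simp add: group_hom_def group_hom_axioms_def)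
  let ?z = "x \<otimes>\<^bsub>D.A\<^esub> inv\<^bsub>D.A\<^esub> y"
  have im: "\<kappa> ` carrier (free_Abelian_group (classes_fg G S)) = kernel D.A G D.\<pi>"
    using \<kappa>(1) by (simp add: Group.iso_iff)
  have "?z \<in> kernel D.A G D.\<pi>" using x y eq by (simp add: kernel_def)
  then obtain f where f: "f \<in> carrier (free_Abelian_group (classes_fg G S))" "?z = \<kappa> f"
    unfolding im[symmetric] by blast
  have "D.cls (inv\<^bsub>D.A\<^esub> y) = - D.cls y"
    using c.hom_closed[OF y] c.hom_inv[OF y] by simp
  then have "D.cls ?z = 0"
    using c.hom_mult[OF x D.A.inv_closed[OF y]] eq(2) by simp
  then have "f = 0" using \<kappa>(2) f by simp
  moreover have "\<kappa> 0 = \<one>\<^bsub>D.A\<^esub>"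
  proof -
    have "\<kappa> \<in> hom (free_Abelian_group (classes_fg G S)) D.A"
      using \<kappa>(1) by (auto simp: iso_def hom_def kernel_def)
    from hom_one[OF this group_free_Abelian_group D.group_A] show ?thesis by simp
  qed
  ultimately have "?z = \<one>\<^bsub>D.A\<^esub>" using f by simp
  then have "inv\<^bsub>D.A\<^esub> (inv\<^bsub>D.A\<^esub> y) = x" using x y by (intro D.A.inv_equality) auto
  then show ?thesis using y by simp
qed

end

section \<open>An equivariant section and the adjoint group of the whole group\<close>

sublocale Cbar_group \<subseteq> U: conj_closed_subset G "carrier G"
  by unfold_locales (auto simp: conj_op_closed)

lemma (in group_hom) hom_conj_op:
  "x \<in> carrier G \<Longrightarrow> y \<in> carrier G \<Longrightarrow> h (x \<triangleleft>\<^bsub>G\<^esub> y) = h x \<triangleleft>\<^bsub>H\<^esub> h y"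
  by (simp add: conj_op_def)

context Cbar_group
begin

lemma cls_conj:
  assumes "x \<in> carrier D.A" "y \<in> carrier D.A"
  shows "D.cls (x \<triangleleft>\<^bsub>D.A\<^esub> y) = D.cls x"
proof -
  interpret c: group_hom D.A "free_Abelian_group (conj_classes G)" D.cls
    using D.cls_hom by (simp add: group_hom_def group_hom_axioms_def)
  interpret F: comm_group "free_Abelian_group (conj_classes G)" by (rule abelian_free_Abelian_group)
  show ?thesis using assms by (simp only: c.hom_conj_op F.conj_op_comm c.hom_closed)
qed

text \<open>The value is forced by \<open>D.e b\<close> on classes with generators and by the unit
  on the class of \<open>\<one>\<close>. On any other class it is the \<open>cls\<close> value of
  some element lying over the class, chosen once for the whole class.\<close>

definition class_value :: "'a set \<Rightarrow> 'a set \<Rightarrow>\<^sub>0 int" where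
  "class_value \<O> = (if \<O> \<inter> S \<noteq> {} then frag_of \<O> else if \<O> = {\<one>} then 0
     else D.cls (SOME w. w \<in> carrier D.A \<and> D.\<pi> w \<in> \<O>))"

text \<open>Prescribing \<open>cls\<close> on each conjugacy class makes the lift unique, and hence equivariant, because
  \<open>cls\<close> is invariant under conjugation.\<close>

definition lift :: "'a \<Rightarrow> 'a word set" where
  "lift b = (THE w. w \<in> carrier D.A \<and> D.\<pi> w = b \<and> D.cls w = class_value (conj_class G b))"

lemma one_notin_Q: "\<one> \<notin> Q"
  using Q_iff[OF one_closed] \<iota>_ne_one conj_class_one by auto

lemma class_value_Q: "b \<in> Q \<Longrightarrow> class_value (conj_class G b) = frag_of (conj_class G b)"
  using Q_iff[of b] Q_carrier by (auto simp: class_value_def)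

lemma class_value_one: "class_value (conj_class G \<one>) = 0"
  using one_notin_Q Q_iff[OF one_closed] by (simp add: class_value_def conj_class_one)

lemma cls_one: "D.cls \<one>\<^bsub>D.A\<^esub> = 0"
  using hom_one[OF D.cls_hom D.group_A group_free_Abelian_group] by simp

lemma lift_unique:
  assumes "w \<in> carrier D.A" "D.cls w = class_value (conj_class G (D.\<pi> w))"
  shows "lift (D.\<pi> w) = w"
  unfolding lift_def
proof (rule the_equality)
  fix v assume "v \<in> carrier D.A \<and> D.\<pi> v = D.\<pi> w \<and> D.cls v = class_value (conj_class G (D.\<pi> w))"
  then show "v = w" using \<pi>_cls_injective[of v w] assms by simp
qed (use assms in simp)

lemma lift_Q: "b \<in> Q \<Longrightarrow> lift b = D.e b"
  using lift_unique[of "D.e b"] by (simp add: D.cls_e class_value_Q)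

lemma lift_one: "lift \<one> = \<one>\<^bsub>D.A\<^esub>"
  using lift_unique[of "\<one>\<^bsub>D.A\<^esub>"] by (simp add: cls_one class_value_one)

lemma lift_exists:
  assumes b: "b \<in> carrier G"
  shows "\<exists>w. w \<in> carrier D.A \<and> D.\<pi> w = b \<and> D.cls w = class_value (conj_class G b)"
proof -
  consider "b \<in> Q" | "b = \<one>" | (other) "b \<notin> Q" "b \<noteq> \<one>" by blast
  then show ?thesis
  proof cases
    case 1
    then show ?thesis by (intro exI[of _ "D.e b"]) (simp add: D.cls_e class_value_Q)
  next
    case 2
    then show ?thesis by (intro exI[of _ "\<one>\<^bsub>D.A\<^esub>"]) (simp add: cls_one class_value_one)
  next
    case other
    let ?O = "conj_class G b"
    have "?O \<noteq> {\<one>}" using conj_class_self[OF b] other(2) by auto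
    moreover have "?O \<inter> S = {}" using Q_iff[OF b] other(1) by simp
    ultimately have v: "class_value ?O = D.cls (SOME w. w \<in> carrier D.A \<and> D.\<pi> w \<in> ?O)"
      by (simp add: class_value_def)
    define w where "w = (SOME w. w \<in> carrier D.A \<and> D.\<pi> w \<in> ?O)"
    have "\<exists>w. w \<in> carrier D.A \<and> D.\<pi> w \<in> ?O"
      using b conj_class_self[OF b] unfolding \<pi>_surj[symmetric] by blast
    then have w: "w \<in> carrier D.A" "D.\<pi> w \<in> ?O" unfolding w_def by (metis (mono_tags, lifting) someI_ex)+
    \<comment> \<open>The chosen \<open>w\<close> lies over some member of the class. Conjugating it
      by a preimage of \<open>g\<close> moves it over \<open>b\<close> and leaves \<open>cls\<close>
      unchanged.\<close>
    have "b \<in> conj_class G (D.\<pi> w)"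
      using conj_class_unique(2)[OF conj_class_in[OF b] w(2)] conj_class_self[OF b] by simp
    then obtain g where g: "g \<in> carrier G" "b = D.\<pi> w \<triangleleft> g"
      unfolding conj_class_eq[OF D.\<pi>.hom_closed[OF w(1)]] by blast
    then obtain u where u: "u \<in> carrier D.A" "D.\<pi> u = g" unfolding \<pi>_surj[symmetric] by blast
    have "w \<triangleleft>\<^bsub>D.A\<^esub> u \<in> carrier D.A" using w u by (simp add: D.A.conj_op_closed)
    moreover have "D.\<pi> (w \<triangleleft>\<^bsub>D.A\<^esub> u) = b" using w u g by (simp add: D.\<pi>.hom_conj_op)
    moreover have "D.cls (w \<triangleleft>\<^bsub>D.A\<^esub> u) = class_value ?O"
      using cls_conj[OF w(1) u(1)] v w_def by simp
    ultimately show ?thesis by blast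
  qed
qed

lemma lift:
  assumes "b \<in> carrier G"
  shows "lift b \<in> carrier D.A" "D.\<pi> (lift b) = b" "D.cls (lift b) = class_value (conj_class G b)"
proof -
  obtain w where w: "w \<in> carrier D.A" "D.\<pi> w = b" "D.cls w = class_value (conj_class G b)"
    using lift_exists[OF assms] by blast
  then have "lift b = w" using lift_unique[of w] by simp
  then show "lift b \<in> carrier D.A" "D.\<pi> (lift b) = b" "D.cls (lift b) = class_value (conj_class G b)"
    using w by simp_all
qed

lemma lift_conj:
  assumes b: "b \<in> carrier G" and w: "w \<in> carrier D.A"
  shows "lift (b \<triangleleft> D.\<pi> w) = lift b \<triangleleft>\<^bsub>D.A\<^esub> w"
proof -
  have c: "lift b \<triangleleft>\<^bsub>D.A\<^esub> w \<in> carrier D.A" using lift(1)[OF b] w by (simp add: D.A.conj_op_closed)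
  have p: "D.\<pi> (lift b \<triangleleft>\<^bsub>D.A\<^esub> w) = b \<triangleleft> D.\<pi> w" using lift[OF b] w by (simp add: D.\<pi>.hom_conj_op)
  have "D.cls (lift b \<triangleleft>\<^bsub>D.A\<^esub> w) = class_value (conj_class G (b \<triangleleft> D.\<pi> w))"
    using lift[OF b] w b by (simp add: cls_conj conj_class_conj_op)
  then show ?thesis using lift_unique[OF c] p by simp
qed

section \<open>The retraction of A(G) onto the Dehn group, and coordinates on the other
  classes\<close>

definition ng :: "'a set set" where
  "ng = classes_ng G S - {{\<one>}}"

text \<open>\<open>\<theta>\<close> is induced by the inclusion of the Dehn quandle into
  \<open>G\<close>. As \<open>lift\<close> extends \<open>D.e\<close>, the map \<open>\<rho>\<close>
  is a left inverse of \<open>\<theta>\<close>.\<close>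

abbreviation "\<rho> \<equiv> pres_hom D.A lift"
abbreviation "\<theta> \<equiv> pres_hom U.A U.e"

text \<open>An exponent sum: for each class in \<open>ng\<close>, the total exponent of the letters
  \<open>e_a\<close> with \<open>a\<close> in that class. The map \<open>\<nu>\<close> counts the
  letter \<open>e_1\<close> in the same way.\<close>

definition \<sigma> :: "'a word set \<Rightarrow> 'a set \<Rightarrow>\<^sub>0 int" where
  "\<sigma> = pres_hom (free_Abelian_group ng)
     (\<lambda>a. if conj_class G a \<in> ng then frag_of (conj_class G a) else 0)"

definition \<nu> :: "'a word set \<Rightarrow> int" where
  "\<nu> = pres_hom integer_group (\<lambda>a. if conj_class G a = {\<one>} then 1 else 0)"

lemma \<rho>_hom: "\<rho> \<in> hom U.A D.A" and \<rho>_e: "a \<in> carrier G \<Longrightarrow> \<rho> (U.e a) = lift a"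
proof -
  have f: "lift \<in> carrier G \<rightarrow> carrier D.A" using lift(1) by blast
  \<comment> \<open>Equivariance of the lift under conjugation by \<open>lift b\<close>, which
    projects to \<open>b\<close>, is the defining relation of the adjoint group.\<close>
  have R: "lift a \<otimes>\<^bsub>D.A\<^esub> lift b = lift b \<otimes>\<^bsub>D.A\<^esub> lift (a \<triangleleft> b)" if ab: "a \<in> carrier G" "b \<in> carrier G" for a b
    using lift_conj[OF ab(1) lift(1)[OF ab(2)]] lift(2)[OF ab(2)]
      D.A.mult_conj_op[OF lift(1)[OF ab(1)] lift(1)[OF ab(2)]] by simp
  show "\<rho> \<in> hom U.A D.A" by (rule U.universal(1)[OF D.group_A f R])
  show "\<rho> (U.e a) = lift a" if "a \<in> carrier G" by (rule U.universal(2)[OF D.group_A f R that])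
qed

lemma \<theta>_hom: "\<theta> \<in> hom D.A U.A" and \<theta>_e: "a \<in> Q \<Longrightarrow> \<theta> (D.e a) = U.e a"
proof -
  have f: "U.e \<in> Q \<rightarrow> carrier U.A" using Q_carrier U.e_closed by blast
  have R: "U.e a \<otimes>\<^bsub>U.A\<^esub> U.e b = U.e b \<otimes>\<^bsub>U.A\<^esub> U.e (a \<triangleleft> b)" if ab: "a \<in> Q" "b \<in> Q" for a b
    by (rule U.e_mult) (use ab Q_carrier in auto)
  show "\<theta> \<in> hom D.A U.A" by (rule D.universal(1)[OF U.group_A f R])
  show "\<theta> (D.e a) = U.e a" if "a \<in> Q" by (rule D.universal(2)[OF U.group_A f R that])
qed

lemma \<sigma>_hom: "\<sigma> \<in> hom U.A (free_Abelian_group ng)"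
  and \<sigma>_e: "a \<in> carrier G \<Longrightarrow> \<sigma> (U.e a) = (if conj_class G a \<in> ng then frag_of (conj_class G a) else 0)"
  unfolding \<sigma>_def
  using U.class_function_hom[OF abelian_free_Abelian_group[of ng], of "\<lambda>\<O>. if \<O> \<in> ng then frag_of \<O> else 0"]
  by auto

lemma \<nu>_hom: "\<nu> \<in> hom U.A integer_group"
  and \<nu>_e: "a \<in> carrier G \<Longrightarrow> \<nu> (U.e a) = (if conj_class G a = {\<one>} then 1 else 0)"
  unfolding \<nu>_def
  using U.class_function_hom[OF abelian_integer_group, of "\<lambda>\<O>. if \<O> = {\<one>} then 1 else 0"]
  by auto

end

sublocale Cbar_group \<subseteq> \<rho>: group_hom U.A D.A \<rho>
  by (simp add: group_hom_def group_hom_axioms_def \<rho>_hom U.group_A D.group_A)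

sublocale Cbar_group \<subseteq> \<theta>: group_hom D.A U.A \<theta>
  by (simp add: group_hom_def group_hom_axioms_def \<theta>_hom U.group_A D.group_A)

sublocale Cbar_group \<subseteq> \<sigma>: group_hom U.A "free_Abelian_group ng" \<sigma>
  by (simp add: group_hom_def group_hom_axioms_def \<sigma>_hom U.group_A)

context Cbar_group
begin

lemma \<pi>_\<theta>: "w \<in> carrier D.A \<Longrightarrow> U.\<pi> (\<theta> w) = D.\<pi> w"
proof -
  assume w: "w \<in> carrier D.A"
  have "(U.\<pi> \<circ> \<theta>) w = D.\<pi> w"
  proof (rule D.hom_eqI[OF is_group Group.hom_compose[OF \<theta>_hom U.\<pi>_hom] D.\<pi>_hom _ w])
    fix a assume "a \<in> Q"
    then show "(U.\<pi> \<circ> \<theta>) (D.e a) = D.\<pi> (D.e a)" using Q_carrier \<theta>_e U.\<pi>_e D.\<pi>_e by (simp add: subset_iff)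
  qed
  then show ?thesis by simp
qed

lemma \<pi>_\<rho>: "x \<in> carrier U.A \<Longrightarrow> D.\<pi> (\<rho> x) = U.\<pi> x"
proof -
  assume x: "x \<in> carrier U.A"
  have "(D.\<pi> \<circ> \<rho>) x = U.\<pi> x"
    by (rule U.hom_eqI[OF is_group Group.hom_compose[OF \<rho>_hom D.\<pi>_hom] U.\<pi>_hom _ x])
      (simp add: \<rho>_e lift(2))
  then show ?thesis by simp
qed

lemma \<rho>_\<theta>: "w \<in> carrier D.A \<Longrightarrow> \<rho> (\<theta> w) = w"
proof -
  assume w: "w \<in> carrier D.A"
  have "(\<rho> \<circ> \<theta>) w = (\<lambda>x. x) w"
  proof (rule D.hom_eqI[OF D.group_A Group.hom_compose[OF \<theta>_hom \<rho>_hom] _ _ w])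
    show "(\<lambda>x. x) \<in> hom D.A D.A" by (simp add: hom_def)
    fix a assume a: "a \<in> Q"
    then have "a \<in> carrier G" using Q_carrier by blast
    then show "(\<rho> \<circ> \<theta>) (D.e a) = D.e a" using a by (simp add: \<theta>_e \<rho>_e lift_Q)
  qed
  then show ?thesis by simp
qed

lemma \<sigma>_Q: "a \<in> Q \<Longrightarrow> \<sigma> (U.e a) = 0"
proof -
  assume a: "a \<in> Q"
  then have c: "a \<in> carrier G" using Q_carrier by blast
  then have "conj_class G a \<notin> ng" using a Q_iff by (simp add: ng_def classes_ng_def)
  then show ?thesis using \<sigma>_e[OF c] by simp
qed

lemma \<sigma>_\<theta>: "w \<in> carrier D.A \<Longrightarrow> \<sigma> (\<theta> w) = 0"
proof -
  assume w: "w \<in> carrier D.A"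
  have "(\<sigma> \<circ> \<theta>) w = (\<lambda>_. 0) w"
  proof (rule D.hom_eqI[OF group_free_Abelian_group Group.hom_compose[OF \<theta>_hom \<sigma>_hom] _ _ w])
    show "(\<lambda>_. 0) \<in> hom D.A (free_Abelian_group ng)" by (simp add: hom_def)
  qed (simp add: \<theta>_e \<sigma>_Q)
  then show ?thesis by simp
qed

lemma conj_class_eq_one_iff: "a \<in> carrier G \<Longrightarrow> conj_class G a = {\<one>} \<longleftrightarrow> a = \<one>"
  using conj_class_self[of a] conj_class_one by auto

definition central_part :: "'a \<Rightarrow> 'a word set" where
  "central_part b = U.e b \<otimes>\<^bsub>U.A\<^esub> inv\<^bsub>U.A\<^esub> (\<theta> (lift b))"

lemma central_part_kernel:
  assumes b: "b \<in> carrier G"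
  shows "central_part b \<in> kernel U.A G U.\<pi>"
  using b lift[OF b] by (simp add: central_part_def kernel_def \<pi>_\<theta>)

lemma central_part_closed: "b \<in> carrier G \<Longrightarrow> central_part b \<in> carrier U.A"
  using central_part_kernel by (simp add: kernel_def)

text \<open>With \<open>w\<close> over \<open>g\<close>, conjugation by \<open>\<theta> w\<close>
  carries both factors for \<open>b\<close> to those for \<open>b \<triangleleft> g\<close>. It also
  fixes \<open>central_part b\<close>, which is central.\<close>

lemma central_part_conj:
  assumes b: "b \<in> carrier G" and g: "g \<in> carrier G"
  shows "central_part (b \<triangleleft> g) = central_part b"
proof -
  obtain w where w: "w \<in> carrier D.A" "D.\<pi> w = g" using g unfolding \<pi>_surj[symmetric] by blast
  have jw: "\<theta> w \<in> carrier U.A" using w by simp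
  have l: "\<theta> (lift b) \<in> carrier U.A" using lift(1)[OF b] by simp
  have "U.e (b \<triangleleft> g) = U.e b \<triangleleft>\<^bsub>U.A\<^esub> \<theta> w"
    using U.e_conj[OF jw b] \<pi>_\<theta>[OF w(1)] w(2) by simp
  moreover have "\<theta> (lift (b \<triangleleft> g)) = \<theta> (lift b) \<triangleleft>\<^bsub>U.A\<^esub> \<theta> w"
    using lift_conj[OF b w(1)] w \<theta>.hom_conj_op[OF lift(1)[OF b] w(1)] by simp
  moreover have "inv\<^bsub>U.A\<^esub> (\<theta> (lift b) \<triangleleft>\<^bsub>U.A\<^esub> \<theta> w) = (inv\<^bsub>U.A\<^esub> \<theta> (lift b)) \<triangleleft>\<^bsub>U.A\<^esub> \<theta> w"
    using l jw by (simp add: conj_op_def[of U.A] U.A.inv_mult_group U.A.m_assoc)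
  ultimately have "central_part (b \<triangleleft> g) = central_part b \<triangleleft>\<^bsub>U.A\<^esub> \<theta> w"
    using U.A.conj_op_distrib[OF U.e_closed[OF b] U.A.inv_closed[OF l] jw]
    by (simp add: central_part_def)
  also have "\<dots> = inv\<^bsub>U.A\<^esub> \<theta> w \<otimes>\<^bsub>U.A\<^esub> (\<theta> w \<otimes>\<^bsub>U.A\<^esub> central_part b)"
    using U.kernel_central[OF central_part_kernel[OF b] jw] jw central_part_closed[OF b]
    by (simp add: conj_op_def[of U.A] U.A.m_assoc)
  also have "\<dots> = central_part b"
    using jw central_part_closed[OF b] by (simp flip: U.A.m_assoc)
  finally show ?thesis .
qed

end

text \<open>Central values of \<open>g\<close> allow \<open>g x\<close> to be moved past
  \<open>f y\<close>.\<close>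

lemma hom_mult_central:
  assumes "group H" "f \<in> hom G H" "g \<in> hom G H"
    and comm: "\<And>x y. x \<in> carrier G \<Longrightarrow> y \<in> carrier H \<Longrightarrow> g x \<otimes>\<^bsub>H\<^esub> y = y \<otimes>\<^bsub>H\<^esub> g x"
  shows "(\<lambda>x. f x \<otimes>\<^bsub>H\<^esub> g x) \<in> hom G H"
proof (rule homI)
  interpret H: group H by fact
  fix x y assume x: "x \<in> carrier G" and y: "y \<in> carrier G"
  note c = hom_in_carrier[OF assms(2) x] hom_in_carrier[OF assms(2) y]
    hom_in_carrier[OF assms(3) x] hom_in_carrier[OF assms(3) y]
  show "f x \<otimes>\<^bsub>H\<^esub> g x \<in> carrier H" using c by simp
  have "f x \<otimes>\<^bsub>H\<^esub> f y \<otimes>\<^bsub>H\<^esub> (g x \<otimes>\<^bsub>H\<^esub> g y) = f x \<otimes>\<^bsub>H\<^esub> (f y \<otimes>\<^bsub>H\<^esub> g x) \<otimes>\<^bsub>H\<^esub> g y"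
    using c by (simp add: H.m_assoc)
  also have "\<dots> = f x \<otimes>\<^bsub>H\<^esub> g x \<otimes>\<^bsub>H\<^esub> (f y \<otimes>\<^bsub>H\<^esub> g y)"
    using c by (simp add: H.m_assoc flip: comm[OF x c(2)])
  finally show "f (x \<otimes>\<^bsub>G\<^esub> y) \<otimes>\<^bsub>H\<^esub> g (x \<otimes>\<^bsub>G\<^esub> y) = f x \<otimes>\<^bsub>H\<^esub> g x \<otimes>\<^bsub>H\<^esub> (f y \<otimes>\<^bsub>H\<^esub> g y)"
    using hom_mult[OF assms(2) x y] hom_mult[OF assms(3) x y] by simp
qed

lemma comm_group_DirProd:
  assumes "comm_group G" "comm_group H"
  shows "comm_group (G \<times>\<times> H)"
proof -
  interpret G: comm_group G by fact
  interpret H: comm_group H by fact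
  show ?thesis
    by (rule group.group_comm_groupI[OF DirProd_group[OF G.is_group H.is_group]])
      (auto simp: G.m_comm H.m_comm)
qed

section \<open>Decomposition of A(G) as a product\<close>

context Cbar_group
begin

abbreviation "e1 \<equiv> U.e \<one>"

lemma e1_kernel: "e1 \<in> kernel U.A G U.\<pi>"
  by (simp add: kernel_def)

lemma e1_pow_kernel: "e1 [^]\<^bsub>U.A\<^esub> (m::int) \<in> kernel U.A G U.\<pi>"
  by (rule U.A.subgroup_int_pow_closed[OF U.\<pi>.subgroup_kernel e1_kernel])

lemma \<rho>_e1_pow: "\<rho> (e1 [^]\<^bsub>U.A\<^esub> (m::int)) = \<one>\<^bsub>D.A\<^esub>"
  using \<rho>.hom_int_pow[of e1 m] by (simp add: \<rho>_e lift_one)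

lemma one_class_notin_ng: "conj_class G \<one> \<notin> ng"
  by (simp add: ng_def conj_class_one)

lemma \<sigma>_e1_pow: "\<sigma> (e1 [^]\<^bsub>U.A\<^esub> (m::int)) = 0"
  using \<sigma>.hom_int_pow[of e1 m] one_class_notin_ng by (simp add: \<sigma>_e)

lemma eps_e1_pow: "adjoint_eps (e1 [^]\<^bsub>U.A\<^esub> (m::int)) = m"
  using hom_int_pow[OF adjoint_eps_hom U.e_closed[OF one_closed] U.group_A group_integer_group, of m]
    adjoint_eps_gen[of \<one> "carrier G"] by simp

text \<open>\<open>\<zeta>\<close> sends a class to the central part of any of its members; it is a
  section of \<open>\<sigma>\<close> that \<open>\<rho>\<close> kills. In the product formula both
  sides are homomorphisms in \<open>x\<close>, because the last two factors are central, so it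
  suffices to compare them on the generators \<open>U.e b\<close>.\<close>

lemma central_decomposition:
  "\<exists>\<zeta> \<in> hom (free_Abelian_group ng) U.A.
     (\<forall>f \<in> carrier (free_Abelian_group ng). \<zeta> f \<in> kernel U.A G U.\<pi> \<and> \<rho> (\<zeta> f) = \<one>\<^bsub>D.A\<^esub> \<and> \<sigma> (\<zeta> f) = f) \<and>
     (\<forall>x \<in> carrier U.A. x = \<theta> (\<rho> x) \<otimes>\<^bsub>U.A\<^esub> \<zeta> (\<sigma> x) \<otimes>\<^bsub>U.A\<^esub> e1 [^]\<^bsub>U.A\<^esub> \<nu> x)"
proof -
  let ?F = "free_Abelian_group ng"
  let ?K = "U.A\<lparr>carrier := kernel U.A G U.\<pi>\<rparr>"
  interpret K: comm_group ?K by (rule U.comm_group_kernel)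
  let ?f = "\<lambda>\<O>. central_part (SOME b. b \<in> \<O>)"
  have cl: "\<O> \<in> conj_classes G" if "\<O> \<in> ng" for \<O> using that by (simp add: ng_def classes_ng_def)
  have some: "(SOME b. b \<in> \<O>) \<in> \<O>" "(SOME b. b \<in> \<O>) \<in> carrier G" if \<O>: "\<O> \<in> ng" for \<O>
  proof -
    show *: "(SOME b. b \<in> \<O>) \<in> \<O>" by (rule someI_ex[OF conj_classes_nonempty[OF cl[OF \<O>]]])
    show "(SOME b. b \<in> \<O>) \<in> carrier G" by (rule conj_class_unique(1)[OF cl[OF \<O>] *])
  qed
  have "?f ` ng \<subseteq> carrier ?K" using central_part_kernel[OF some(2)] by auto
  then obtain \<zeta> where \<zeta>: "\<zeta> \<in> hom ?F ?K" "\<And>\<O>. \<O> \<in> ng \<Longrightarrow> \<zeta> (frag_of \<O>) = ?f \<O>"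
    using K.free_Abelian_group_universal[of ?f ng] by blast
  have ker: "\<zeta> f \<in> kernel U.A G U.\<pi>" if "f \<in> carrier ?F" for f
    using hom_in_carrier[OF \<zeta>(1) that] by simp
  have \<zeta>A: "\<zeta> \<in> hom ?F U.A" using \<zeta>(1) by (auto simp: hom_def kernel_def)
  interpret \<zeta>: group_hom ?F U.A \<zeta> using \<zeta>A by (simp add: group_hom_def group_hom_axioms_def)
  have val: "\<zeta> (frag_of (conj_class G b)) = central_part b"
    if b: "b \<in> carrier G" "conj_class G b \<in> ng" for b
  proof -
    obtain g where "g \<in> carrier G" "(SOME c. c \<in> conj_class G b) = b \<triangleleft> g"
      using some(1)[OF b(2)] conj_class_eq[OF b(1)] by (metis imageE)
    then show ?thesis using \<zeta>(2)[OF b(2)] central_part_conj[OF b(1)] by simp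
  qed
  have \<rho>c: "\<rho> (central_part b) = \<one>\<^bsub>D.A\<^esub>" if b: "b \<in> carrier G" for b
    using b lift(1)[OF b] by (simp add: central_part_def \<rho>_e \<rho>_\<theta>)
  have \<sigma>c: "\<sigma> (central_part b) = frag_of (conj_class G b)"
    if b: "b \<in> carrier G" "conj_class G b \<in> ng" for b
    using b lift(1)[OF b(1)] \<sigma>.hom_inv[of "\<theta> (lift b)"] by (simp add: central_part_def \<sigma>_e \<sigma>_\<theta>)
  have cls_some: "conj_class G (SOME b. b \<in> \<O>) = \<O>" if "\<O> \<in> ng" for \<O>
    by (rule conj_class_unique(2)[OF cl[OF that] some(1)[OF that]])
  have \<rho>\<zeta>: "\<rho> (\<zeta> f) = \<one>\<^bsub>D.A\<^esub>" and \<sigma>\<zeta>: "\<sigma> (\<zeta> f) = f" if f: "f \<in> carrier ?F" for f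
  proof -
    have inv: "\<zeta> (x - y) = \<zeta> x \<otimes>\<^bsub>U.A\<^esub> inv\<^bsub>U.A\<^esub> (\<zeta> y)"
      if "Poly_Mapping.keys x \<subseteq> ng" "Poly_Mapping.keys y \<subseteq> ng" for x y
      using \<zeta>.hom_mult[of x "- y"] \<zeta>.hom_inv[of y] that by simp
    have cc: "\<zeta> x \<in> carrier U.A" if "Poly_Mapping.keys x \<subseteq> ng" for x
      using \<zeta>.hom_closed that by simp
    have keys: "Poly_Mapping.keys f \<subseteq> ng" using f by simp
    show "\<rho> (\<zeta> f) = \<one>\<^bsub>D.A\<^esub>"
    proof (rule free_Abelian_group_induct[OF keys])
      show "\<rho> (\<zeta> 0) = \<one>\<^bsub>D.A\<^esub>" using \<zeta>.hom_one by simp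
      show "\<rho> (\<zeta> (frag_of \<O>)) = \<one>\<^bsub>D.A\<^esub>" if "\<O> \<in> ng" for \<O>
        using \<zeta>(2)[OF that] \<rho>c[OF some(2)[OF that]] by simp
    qed (simp add: inv cc)
    show "\<sigma> (\<zeta> f) = f"
    proof (rule free_Abelian_group_induct[OF keys])
      show "\<sigma> (\<zeta> 0) = 0" using \<zeta>.hom_one \<sigma>.hom_one by simp
      show "\<sigma> (\<zeta> (frag_of \<O>)) = frag_of \<O>" if "\<O> \<in> ng" for \<O>
        using \<zeta>(2)[OF that] \<sigma>c[OF some(2)[OF that]] cls_some[OF that] that by simp
      fix x y assume xy: "Poly_Mapping.keys x \<subseteq> ng" "Poly_Mapping.keys y \<subseteq> ng"
        "\<sigma> (\<zeta> x) = x" "\<sigma> (\<zeta> y) = y"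
      then show "\<sigma> (\<zeta> (x - y)) = x - y"
        using \<sigma>.hom_mult[OF cc[OF xy(1)] U.A.inv_closed[OF cc[OF xy(2)]]] \<sigma>.hom_inv[OF cc[OF xy(2)]]
        by (simp add: inv)
    qed
  qed
  have "x = \<theta> (\<rho> x) \<otimes>\<^bsub>U.A\<^esub> \<zeta> (\<sigma> x) \<otimes>\<^bsub>U.A\<^esub> e1 [^]\<^bsub>U.A\<^esub> \<nu> x" if x: "x \<in> carrier U.A" for x
  proof (rule U.hom_eqI[OF U.group_A _ _ _ x])
    show "(\<lambda>x. x) \<in> hom U.A U.A" by (simp add: hom_def)
    have "(\<lambda>x. (\<theta> \<circ> \<rho>) x \<otimes>\<^bsub>U.A\<^esub> (\<zeta> \<circ> \<sigma>) x) \<in> hom U.A U.A"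
      by (rule hom_mult_central[OF U.group_A Group.hom_compose[OF \<rho>_hom \<theta>_hom] Group.hom_compose[OF \<sigma>_hom \<zeta>A]])
        (use U.kernel_central ker \<sigma>.hom_closed in auto)
    moreover have "([^]\<^bsub>U.A\<^esub>) e1 \<circ> \<nu> \<in> hom U.A U.A"
      by (rule Group.hom_compose[OF \<nu>_hom U.A.hom_integer_group_pow]) simp
    ultimately have "(\<lambda>x. (\<lambda>x. (\<theta> \<circ> \<rho>) x \<otimes>\<^bsub>U.A\<^esub> (\<zeta> \<circ> \<sigma>) x) x \<otimes>\<^bsub>U.A\<^esub> (([^]\<^bsub>U.A\<^esub>) e1 \<circ> \<nu>) x) \<in> hom U.A U.A"
      by (rule hom_mult_central[OF U.group_A]) (use U.kernel_central e1_pow_kernel in auto)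
    then show "(\<lambda>x. \<theta> (\<rho> x) \<otimes>\<^bsub>U.A\<^esub> \<zeta> (\<sigma> x) \<otimes>\<^bsub>U.A\<^esub> e1 [^]\<^bsub>U.A\<^esub> \<nu> x) \<in> hom U.A U.A" by simp
    fix b assume b: "b \<in> carrier G"
    have \<zeta>0: "\<zeta> 0 = \<one>\<^bsub>U.A\<^esub>" using \<zeta>.hom_one by simp
    have tl: "\<theta> (lift b) \<in> carrier U.A" using lift(1)[OF b] by simp
    \<comment> \<open>For \<open>b = \<one>\<close> only the power of \<open>e1\<close> survives,
      and for \<open>b\<close> in \<open>Q\<close> only \<open>\<theta> (lift b)\<close>. Otherwise
      the power of \<open>e1\<close> is trivial and \<open>\<theta> (lift b)\<close> is completed to
      \<open>U.e b\<close> by \<open>central_part b\<close>.\<close>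
    consider "b = \<one>" | (gen) "b \<in> Q" | (other) "b \<noteq> \<one>" "b \<notin> Q" by blast
    then have "\<theta> (lift b) \<otimes>\<^bsub>U.A\<^esub> \<zeta> (\<sigma> (U.e b)) \<otimes>\<^bsub>U.A\<^esub> e1 [^]\<^bsub>U.A\<^esub> \<nu> (U.e b) = U.e b"
    proof cases
      case 1
      have "\<sigma> e1 = 0" "\<nu> e1 = 1" using one_class_notin_ng by (simp_all add: \<sigma>_e \<nu>_e conj_class_one)
      then show ?thesis using 1 \<zeta>0 by (simp add: lift_one U.A.int_pow_1)
    next
      case gen
      then have "\<nu> (U.e b) = 0" using \<nu>_e[OF b] conj_class_eq_one_iff[OF b] one_notin_Q by auto
      then show ?thesis using gen b \<zeta>0 by (simp add: lift_Q \<theta>_e \<sigma>_Q)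
    next
      case other
      then have ne: "conj_class G b \<noteq> {\<one>}" using conj_class_eq_one_iff[OF b] by simp
      then have ng: "conj_class G b \<in> ng"
        using other Q_iff[OF b] conj_class_in[OF b] by (simp add: ng_def classes_ng_def)
      have "\<theta> (lift b) \<otimes>\<^bsub>U.A\<^esub> central_part b = central_part b \<otimes>\<^bsub>U.A\<^esub> \<theta> (lift b)"
        by (rule U.kernel_central[OF central_part_kernel[OF b] tl, symmetric])
      also have "\<dots> = U.e b" using tl b by (simp add: central_part_def U.A.m_assoc)
      finally show ?thesis using ne ng b by (simp add: \<sigma>_e \<nu>_e val)
    qed
    then show "U.e b = \<theta> (\<rho> (U.e b)) \<otimes>\<^bsub>U.A\<^esub> \<zeta> (\<sigma> (U.e b)) \<otimes>\<^bsub>U.A\<^esub> e1 [^]\<^bsub>U.A\<^esub> \<nu> (U.e b)"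
      using b by (simp add: \<rho>_e)
  qed
  then show ?thesis using \<zeta>A ker \<rho>\<zeta> \<sigma>\<zeta> by blast
qed

end

section \<open>Stabilisers and their abelianisations\<close>

context Cbar_group
begin

lemma group_stab_dehn: "a \<in> carrier G \<Longrightarrow> group (stab_dehn G S a)"
  unfolding stab_dehn_def dehn_group_def
  by (rule D.A.subgroup_imp_group[OF D.subgroup_stabilizer_adjoint_act])

lemma carrier_stab_dehn:
  "a \<in> carrier G \<Longrightarrow> carrier (stab_dehn G S a) = {w \<in> carrier D.A. a \<triangleleft> D.\<pi> w = a}"
  by (simp add: stab_dehn_def dehn_group_def D.stabilizer_adjoint_act)

lemma mult_stab_dehn: "mult (stab_dehn G S a) = mult D.A"
  by (simp add: stab_dehn_def dehn_group_def)

lemma group_stab_A_eps: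
  assumes "a \<in> carrier G" shows "group (stab_A_eps G a)"
proof -
  interpret \<epsilon>: group_hom U.A integer_group adjoint_eps
    using adjoint_eps_hom by (simp add: group_hom_def group_hom_axioms_def U.group_A)
  show ?thesis
    unfolding stab_A_eps_def Let_def
    by (rule U.A.subgroup_imp_group[OF U.A.subgroups_Inter_pair[OF
          U.subgroup_stabilizer_adjoint_act[OF assms] \<epsilon>.subgroup_kernel]])
qed

lemma carrier_stab_A_eps:
  "a \<in> carrier G \<Longrightarrow>
   carrier (stab_A_eps G a) = {x \<in> carrier U.A. a \<triangleleft> U.\<pi> x = a \<and> adjoint_eps x = 0}"
  by (auto simp: stab_A_eps_def Let_def U.stabilizer_adjoint_act kernel_def)

lemma mult_stab_A_eps: "mult (stab_A_eps G a) = mult U.A"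
  by (simp add: stab_A_eps_def Let_def)

text \<open>As \<open>e1\<close> is central and has degree 1, every element of the adjoint group can be moved into the
  kernel of the degree map by a power of \<open>e1\<close>, at the cost of changing neither \<open>\<rho>\<close> nor \<open>\<sigma>\<close>.\<close>

definition degree_zero :: "'a word set \<Rightarrow> 'a word set" where
  "degree_zero x = x \<otimes>\<^bsub>U.A\<^esub> e1 [^]\<^bsub>U.A\<^esub> (- adjoint_eps x)"

lemma degree_zero_hom: "degree_zero \<in> hom U.A U.A"
proof -
  have "uminus \<in> hom integer_group integer_group" by (simp add: hom_def)
  then have "uminus \<circ> adjoint_eps \<in> hom U.A integer_group"
    by (rule Group.hom_compose[OF adjoint_eps_hom])
  then have pow: "([^]\<^bsub>U.A\<^esub>) e1 \<circ> (uminus \<circ> adjoint_eps) \<in> hom U.A U.A"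
    by (rule Group.hom_compose[OF _ U.A.hom_integer_group_pow]) simp
  have "(\<lambda>x. x) \<in> hom U.A U.A" by (simp add: hom_def)
  from hom_mult_central[OF U.group_A this pow]
  have "(\<lambda>x. x \<otimes>\<^bsub>U.A\<^esub> (([^]\<^bsub>U.A\<^esub>) e1 \<circ> (uminus \<circ> adjoint_eps)) x) \<in> hom U.A U.A"
    using U.kernel_central e1_pow_kernel by simp
  then show ?thesis by (simp add: degree_zero_def[abs_def])
qed

lemma degree_zero:
  assumes x: "x \<in> carrier U.A"
  shows "degree_zero x \<in> carrier U.A" "U.\<pi> (degree_zero x) = U.\<pi> x" "adjoint_eps (degree_zero x) = 0"
    "\<rho> (degree_zero x) = \<rho> x" "\<sigma> (degree_zero x) = \<sigma> x"
proof -
  interpret \<epsilon>: group_hom U.A integer_group adjoint_eps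
    using adjoint_eps_hom by (simp add: group_hom_def group_hom_axioms_def U.group_A)
  have p: "e1 [^]\<^bsub>U.A\<^esub> m \<in> carrier U.A" "U.\<pi> (e1 [^]\<^bsub>U.A\<^esub> m) = \<one>" for m :: int
    using e1_pow_kernel[of m] by (auto simp: kernel_def)
  show "degree_zero x \<in> carrier U.A" "U.\<pi> (degree_zero x) = U.\<pi> x" "adjoint_eps (degree_zero x) = 0"
    "\<rho> (degree_zero x) = \<rho> x" "\<sigma> (degree_zero x) = \<sigma> x"
    using x p by (simp_all add: degree_zero_def eps_e1_pow \<rho>_e1_pow \<sigma>_e1_pow)
qed

text \<open>The criterion \<open>abelianisation_isoI\<close> is applied to the map
  \<open>?h\<close>. Stabilising \<open>a\<close> depends only on \<open>\<pi>\<close>, which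
  \<open>\<rho>\<close> and \<open>\<theta>\<close> preserve and the central factors do not affect,
  so the decomposition of A(G) restricts to stabilisers.\<close>

lemma abelianisation_stab_A_eps:
  assumes a: "a \<in> carrier G"
  shows "abelianisation (stab_A_eps G a) \<cong> abelianisation (stab_dehn G S a) \<times>\<times> free_Abelian_group ng"
proof -
  let ?D = "stab_dehn G S a" and ?K = "stab_A_eps G a" and ?F = "free_Abelian_group ng"
  note cD = carrier_stab_dehn[OF a] and cK = carrier_stab_A_eps[OF a]
  interpret D': group ?D by (rule group_stab_dehn[OF a])
  interpret K: group ?K by (rule group_stab_A_eps[OF a])
  interpret \<epsilon>: group_hom U.A integer_group adjoint_eps
    using adjoint_eps_hom by (simp add: group_hom_def group_hom_axioms_def U.group_A)
  obtain \<zeta> where \<zeta>hom: "\<zeta> \<in> hom ?F U.A"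
    and \<zeta>: "\<And>f. f \<in> carrier ?F \<Longrightarrow> \<zeta> f \<in> kernel U.A G U.\<pi> \<and> \<rho> (\<zeta> f) = \<one>\<^bsub>D.A\<^esub> \<and> \<sigma> (\<zeta> f) = f"
    and dec: "\<And>x. x \<in> carrier U.A \<Longrightarrow> x = \<theta> (\<rho> x) \<otimes>\<^bsub>U.A\<^esub> \<zeta> (\<sigma> x) \<otimes>\<^bsub>U.A\<^esub> e1 [^]\<^bsub>U.A\<^esub> \<nu> x"
    using central_decomposition by metis
  let ?h = "\<lambda>x. (ab_proj ?D (\<rho> x), \<sigma> x)"
  have T: "comm_group (abelianisation ?D \<times>\<times> ?F)"
    by (rule comm_group_DirProd[OF D'.comm_group_abelianisation abelian_free_Abelian_group])
  have \<rho>D: "\<rho> \<in> hom ?K ?D"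
    by (rule homI) (auto simp: cK cD \<pi>_\<rho> mult_stab_dehn mult_stab_A_eps)
  have \<sigma>K: "\<sigma> \<in> hom ?K ?F"
    using \<sigma>_hom unfolding hom_def mult_stab_A_eps cK by auto
  have h: "?h \<in> hom ?K (abelianisation ?D \<times>\<times> ?F)"
    using Group.hom_compose[OF \<rho>D D'.ab_proj_hom] \<sigma>K by (simp add: hom_paired o_def)
  have surj: "?h ` carrier ?K = carrier (abelianisation ?D \<times>\<times> ?F)"
  proof
    show "?h ` carrier ?K \<subseteq> carrier (abelianisation ?D \<times>\<times> ?F)"
      using h by (auto simp: hom_def)
    show "carrier (abelianisation ?D \<times>\<times> ?F) \<subseteq> ?h ` carrier ?K"
    proof
      fix t assume "t \<in> carrier (abelianisation ?D \<times>\<times> ?F)"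
      then obtain V f where t: "t = (V, f)" "V \<in> carrier (abelianisation ?D)" "f \<in> carrier ?F" by auto
      obtain w where w: "w \<in> carrier ?D" "V = ab_proj ?D w"
        using t(2) unfolding D'.ab_proj_surj[symmetric] by blast
      have wD: "w \<in> carrier D.A" "a \<triangleleft> D.\<pi> w = a" using w(1) cD by auto
      have zc: "\<zeta> f \<in> carrier U.A" "U.\<pi> (\<zeta> f) = \<one>" using \<zeta>[OF t(3)] by (auto simp: kernel_def)
      \<comment> \<open>\<open>\<theta> w\<close> has the required value under \<open>\<rho>\<close>
        and is killed by \<open>\<sigma>\<close>, while \<open>\<zeta> f\<close> does the opposite.
        \<open>degree_zero\<close> then adjusts only the degree.\<close>
      let ?y = "\<theta> w \<otimes>\<^bsub>U.A\<^esub> \<zeta> f"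
      have yc: "?y \<in> carrier U.A" using wD zc by simp
      have "U.\<pi> ?y = D.\<pi> w" using wD zc by (simp add: \<pi>_\<theta>)
      then have "degree_zero ?y \<in> carrier ?K" using degree_zero[OF yc] wD by (simp add: cK)
      moreover have "\<rho> (degree_zero ?y) = w" "\<sigma> (degree_zero ?y) = f"
        using degree_zero(4,5)[OF yc] wD zc \<zeta>[OF t(3)] by (simp_all add: \<rho>_\<theta> \<sigma>_\<theta>)
      ultimately show "t \<in> ?h ` carrier ?K" using t w by (metis (no_types, lifting) imageI)
    qed
  qed
  have ker: "kernel ?K (abelianisation ?D \<times>\<times> ?F) ?h \<subseteq> derived ?K (carrier ?K)"
  proof
    fix x assume x: "x \<in> kernel ?K (abelianisation ?D \<times>\<times> ?F) ?h"
    then have xK: "x \<in> carrier ?K" and x1: "ab_proj ?D (\<rho> x) = \<one>\<^bsub>abelianisation ?D\<^esub>" and x2: "\<sigma> x = 0"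
      by (auto simp: kernel_def DirProd_def)
    have xU: "x \<in> carrier U.A" and \<epsilon>x: "adjoint_eps x = 0" using xK cK by auto
    have \<rho>x: "\<rho> x \<in> derived ?D (carrier ?D)"
      using D'.ab_proj_eq_one_iff[OF hom_in_carrier[OF \<rho>D xK]] x1 by simp
    have tr: "\<theta> (\<rho> x) \<in> carrier U.A" using xU by simp
    have "\<zeta> 0 = \<one>\<^bsub>U.A\<^esub>" using hom_one[OF \<zeta>hom group_free_Abelian_group U.group_A] by simp
    then have x': "x = \<theta> (\<rho> x) \<otimes>\<^bsub>U.A\<^esub> e1 [^]\<^bsub>U.A\<^esub> \<nu> x" using dec[OF xU] x2 tr by simp
    \<comment> \<open>As \<open>x\<close> has degree 0, the exponent of \<open>e1\<close> must
      cancel the degree of \<open>\<theta> (\<rho> x)\<close>, which is exactly the correction made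
      by \<open>degree_zero\<close>.\<close>
    have "adjoint_eps x = adjoint_eps (\<theta> (\<rho> x)) + \<nu> x"
      by (subst x') (use tr in \<open>simp add: eps_e1_pow\<close>)
    then have "\<nu> x = - adjoint_eps (\<theta> (\<rho> x))" using \<epsilon>x by simp
    then have xd: "x = (degree_zero \<circ> \<theta>) (\<rho> x)" using x' by (simp add: degree_zero_def)
    have dt: "degree_zero \<circ> \<theta> \<in> hom D.A U.A" by (rule Group.hom_compose[OF \<theta>_hom degree_zero_hom])
    \<comment> \<open>As a homomorphism between the two stabilisers, this map carries
      \<open>\<rho> x\<close>, a member of the derived subgroup, to the member \<open>x\<close> of
      the derived subgroup.\<close>
    have "degree_zero \<circ> \<theta> \<in> hom ?D ?K"
    proof (rule homI)
      fix v w assume v: "v \<in> carrier ?D" and w: "w \<in> carrier ?D"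
      have vw: "v \<in> carrier D.A" "w \<in> carrier D.A" "a \<triangleleft> D.\<pi> v = a" using v w cD by auto
      then show "(degree_zero \<circ> \<theta>) v \<in> carrier ?K" by (simp add: cK degree_zero \<pi>_\<theta>)
      show "(degree_zero \<circ> \<theta>) (v \<otimes>\<^bsub>?D\<^esub> w) = (degree_zero \<circ> \<theta>) v \<otimes>\<^bsub>?K\<^esub> (degree_zero \<circ> \<theta>) w"
        unfolding mult_stab_dehn mult_stab_A_eps by (rule hom_mult[OF dt vw(1,2)])
    qed
    then interpret dt: group_hom ?D ?K "degree_zero \<circ> \<theta>"
      by (simp add: group_hom_def group_hom_axioms_def D'.is_group K.is_group)
    have "x \<in> (degree_zero \<circ> \<theta>) ` derived ?D (carrier ?D)" using xd \<rho>x by (rule image_eqI)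
    also have "\<dots> = derived ?K ((degree_zero \<circ> \<theta>) ` carrier ?D)" by (rule dt.derived_img[symmetric]) simp
    also have "\<dots> \<subseteq> derived ?K (carrier ?K)"
      by (rule K.mono_derived) (use dt.hom_closed in blast)
    finally show "x \<in> derived ?K (carrier ?K)" .
  qed
  show ?thesis by (rule K.abelianisation_isoI[OF T h surj ker])
qed

text \<open>An instance of \<open>short_exact_abelianisation\<close> in which \<open>cls\<close>,
  restricted to the stabiliser, plays the role of \<open>c\<close>.\<close>

lemma short_exact_stab:
  assumes a: "a \<in> carrier G"
    and \<kappa>: "\<kappa> \<in> iso (free_Abelian_group (classes_fg G S)) (D.A\<lparr>carrier := kernel D.A G D.\<pi>\<rparr>)"
    and inj: "\<forall>f \<in> carrier (free_Abelian_group (classes_fg G S)). D.cls (\<kappa> f) = 0 \<longrightarrow> f = 0"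
  shows "short_exact (free_Abelian_group (classes_fg G S))
    (abelianisation (stab_dehn G S a)) (abelianisation (stab_group G a))
    (ab_proj (stab_dehn G S a) \<circ> \<kappa>) (ab_map (stab_group G a) (adjoint_proj G))"
proof -
  let ?D = "stab_dehn G S a" and ?H = "stab_group G a" and ?F = "free_Abelian_group (classes_fg G S)"
  note cD = carrier_stab_dehn[OF a]
  have cH: "carrier ?H = {g \<in> carrier G. a \<triangleleft> g = a}"
    by (simp add: stab_group_def stabilizer_conj_act[OF a])
  have mH: "mult ?H = mult G" "\<one>\<^bsub>?H\<^esub> = \<one>" by (simp_all add: stab_group_def)
  have H: "group ?H"
    unfolding stab_group_def by (rule subgroup_imp_group[OF subgroup_stabilizer_conj_act[OF a]])
  have "adjoint_proj G \<in> hom ?D ?H"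
    by (rule homI) (auto simp: cD cH mult_stab_dehn mH)
  then interpret p: group_hom ?D ?H "adjoint_proj G"
    by (simp add: group_hom_def group_hom_axioms_def group_stab_dehn[OF a] H)
  \<comment> \<open>Elements of the kernel of \<open>\<pi>\<close> act trivially, so all of them
    stabilise \<open>a\<close> and restriction does not shrink the kernel.\<close>
  have ker: "kernel ?D ?H (adjoint_proj G) = kernel D.A G D.\<pi>"
    using a by (auto simp: kernel_def cD mH)
  have im: "\<kappa> ` carrier ?F = kernel D.A G D.\<pi>" using \<kappa> by (simp add: Group.iso_iff)
  have kD: "kernel D.A G D.\<pi> \<subseteq> carrier ?D" using a by (auto simp: kernel_def cD)
  show ?thesis
  proof (rule p.short_exact_abelianisation)
    show "adjoint_proj G ` carrier ?D = carrier ?H"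
    proof
      show "adjoint_proj G ` carrier ?D \<subseteq> carrier ?H" using p.hom_closed by blast
      show "carrier ?H \<subseteq> adjoint_proj G ` carrier ?D"
      proof
        fix g assume "g \<in> carrier ?H"
        then have g: "g \<in> carrier G" "a \<triangleleft> g = a" using cH by auto
        then obtain w where "w \<in> carrier D.A" "D.\<pi> w = g" unfolding \<pi>_surj[symmetric] by blast
        then show "g \<in> adjoint_proj G ` carrier ?D" using g by (auto simp: cD)
      qed
    qed
    show "\<kappa> \<in> hom ?F ?D"
    proof (rule homI)
      show "\<kappa> f \<in> carrier ?D" if "f \<in> carrier ?F" for f using im kD that by blast
      show "\<kappa> (f \<otimes>\<^bsub>?F\<^esub> g) = \<kappa> f \<otimes>\<^bsub>?D\<^esub> \<kappa> g" if "f \<in> carrier ?F" "g \<in> carrier ?F" for f g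
        using hom_mult[of \<kappa> ?F "D.A\<lparr>carrier := kernel D.A G D.\<pi>\<rparr>" f g] \<kappa> that
        by (simp add: iso_def mult_stab_dehn)
    qed
    show "\<kappa> ` carrier ?F = kernel ?D ?H (adjoint_proj G)" using im ker by simp
    show "comm_group (free_Abelian_group (conj_classes G))" by (rule abelian_free_Abelian_group)
    show "D.cls \<in> hom ?D (free_Abelian_group (conj_classes G))"
      using D.cls_hom unfolding hom_def mult_stab_dehn cD by auto
    show "f = \<one>\<^bsub>?F\<^esub>" if "f \<in> carrier ?F" "D.cls (\<kappa> f) = \<one>\<^bsub>free_Abelian_group (conj_classes G)\<^esub>" for f
      using inj that by simp
  qed simp
qed

end

theorem proposition6p1:
  fixes G :: "('g, 'm) monoid_scheme"
    and \<Gamma> :: "'x set" and C :: "('x \<times> 'x \<times> 'x) set" and P :: "('x \<times> nat) set"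
    and \<iota> :: "'x \<Rightarrow> 'g" and \<O> :: "'g set" and a :: 'g
  assumes "Cbar_presentation G \<Gamma> C P \<iota>"
    and "\<O> \<in> conj_classes G"
    and "a \<in> \<O>"
  shows "abelianisation (stab_A_eps G a) \<cong>
           abelianisation (stab_dehn G (\<iota> ` \<Gamma>) a) \<times>\<times>
           free_Abelian_group (classes_ng G (\<iota> ` \<Gamma>) - {{\<one>\<^bsub>G\<^esub>}})
       \<and> (\<exists>\<kappa> \<in> iso (free_Abelian_group (classes_fg G (\<iota> ` \<Gamma>)))
                   ((dehn_group G (\<iota> ` \<Gamma>))
                      \<lparr>carrier := kernel (dehn_group G (\<iota> ` \<Gamma>)) G (adjoint_proj G)\<rparr>).
            (\<forall>\<O>' \<in> classes_fg G (\<iota> ` \<Gamma>). \<forall>b \<in> \<O>'.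
               \<kappa> (frag_of \<O>') =
                 adjoint_gen G (dehn_quandle G (\<iota> ` \<Gamma>)) b
                   [^]\<^bsub>dehn_group G (\<iota> ` \<Gamma>)\<^esub> class_order G \<O>') \<and>
            short_exact
              (free_Abelian_group (classes_fg G (\<iota> ` \<Gamma>)))
              (abelianisation (stab_dehn G (\<iota> ` \<Gamma>) a))
              (abelianisation (stab_group G a))
              (ab_proj (stab_dehn G (\<iota> ` \<Gamma>) a) \<circ> \<kappa>)
              (ab_map (stab_group G a) (adjoint_proj G)))"
proof -
  interpret Cbar_group G \<Gamma> C P \<iota>
    using assms(1) by (simp add: Cbar_group_def Cbar_group_axioms_def Cbar_presentation_def)
  have a: "a \<in> carrier G" by (rule conj_class_unique(1)[OF assms(2,3)])
  show ?thesis
    \<comment> \<open>The same \<open>\<kappa>\<close>, taken from \<open>kernel_iso\<close>,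
      provides the prescribed values and the first map of the sequence.\<close>
    using abelianisation_stab_A_eps[OF a] kernel_iso short_exact_stab[OF a]
    unfolding ng_def dehn_group_def by blast
qed

end
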